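(* Let $G=(V,E)$ be a finite undirected graph and let $T\subseteq V$. Then the set $J_{\rm vertex}(G,T)\subseteq\mathbb{Z}^T$ of vertex-feasible vectors and the set $J_{\rm edge}(G,T)\subseteq\mathbb{Z}^T$ of edge-feasible vectors are both jump systems.
   Context: A $T$-path is a path $P$ in $G$ such that $V(P)\cap T$ consists exactly of the two (distinct) endpoints of $P$. Two $T$-paths $P,Q$ are openly disjoint if $V(P)\cap V(Q)\subseteq T$, and edge-disjoint if $E(P)\cap E(Q)=\emptyset$. A vector $m\in\mathbb{Z}^T$ is vertex-feasible (resp. edge-feasible) if there exists a set of pairwise openly disjoint (resp. pairwise edge-disjoint) $T$-paths such that each $t\in T$ is the endpoint of exactly $m(t)$ of these paths. $J_{\rm vertex}(G,T)$ and $J_{\rm edge}(G,T)$ denote the sets of all vertex-feasible, resp. edge-feasible, vectors. For $s\in T$, $e_s\in\{0,1\}^T$ is the unit vector with $e_s(s)=1$ and $e_s(t)=0$ for $t\neq s$. For $x,y\in\mathbb{Z}^T$, a step from $x$ to $y$ is: $x$ itself if $x=y$; or $x+e_s$ for some $s\in T$ with $x_s<y_s$; or $x-e_s$ for some $s\in T$ with $x_s>y_s$. A set $J\subseteq\mathbb{Z}^T$ is a jump system if for every $x,y\in J$ and every step $x'$ from $x$ to $y$, either $x'\in J$ or there is a step $x''$ from $x'$ to $y$ with $x''\in J$. *)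

theory Defs
  imports Main
begin

text \<open>
  Undirected graphs, with parallel edges and loops permitted: the map \<open>ends\<close> sends an edge to the
  set of its one or two end vertices. A simple graph with edge set \<open>E \<subseteq> {{u, v} | u v. u \<noteq> v}\<close>
  is the case in which \<open>ends\<close> is the identity.
\<close>

record ('v, 'e) ugraph =
  verts :: "'v set"
  edges :: "'e set"
  ends :: "'e \<Rightarrow> 'v set"

definition finite_ugraph :: "('v, 'e) ugraph \<Rightarrow> bool" where
  "finite_ugraph G \<longleftrightarrow>
     finite (verts G) \<and> finite (edges G) \<and>
     (\<forall>e \<in> edges G. ends G e \<subseteq> verts G \<and> card (ends G e) \<in> {1, 2})"

text \<open>
  A path is a subgraph, given by its vertex set and its edge set, and not a traversal sequence:
  otherwise a path and its reversal would count as two members of a set of paths.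
\<close>

type_synonym ('v, 'e) upath = "'v set \<times> 'e set"

abbreviation path_verts :: "('v, 'e) upath \<Rightarrow> 'v set" where
  "path_verts P \<equiv> fst P"

abbreviation path_edges :: "('v, 'e) upath \<Rightarrow> 'e set" where
  "path_edges P \<equiv> snd P"

definition path_between :: "('v, 'e) ugraph \<Rightarrow> 'v \<Rightarrow> 'v \<Rightarrow> ('v, 'e) upath \<Rightarrow> bool" where
  "path_between G s t P \<longleftrightarrow>
     (\<exists>vs es. length vs = Suc (length es) \<and> distinct vs \<and>
        set vs \<subseteq> verts G \<and> set es \<subseteq> edges G \<and>
        (\<forall>i < length es. ends G (es ! i) = {vs ! i, vs ! Suc i}) \<and>
        hd vs = s \<and> last vs = t \<and>
        path_verts P = set vs \<and> path_edges P = set es)"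

definition is_endpoint :: "('v, 'e) ugraph \<Rightarrow> ('v, 'e) upath \<Rightarrow> 'v \<Rightarrow> bool" where
  "is_endpoint G P t \<longleftrightarrow> (\<exists>u. path_between G t u P)"

definition T_path :: "('v, 'e) ugraph \<Rightarrow> 'v set \<Rightarrow> ('v, 'e) upath \<Rightarrow> bool" where
  "T_path G T P \<longleftrightarrow>
     (\<exists>s t. s \<noteq> t \<and> path_between G s t P \<and> path_verts P \<inter> T = {s, t})"

definition openly_disjoint :: "'v set \<Rightarrow> ('v, 'e) upath \<Rightarrow> ('v, 'e) upath \<Rightarrow> bool" where
  "openly_disjoint T P Q \<longleftrightarrow> path_verts P \<inter> path_verts Q \<subseteq> T"

definition edge_disjoint :: "('v, 'e) upath \<Rightarrow> ('v, 'e) upath \<Rightarrow> bool" where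
  "edge_disjoint P Q \<longleftrightarrow> path_edges P \<inter> path_edges Q = {}"

text \<open>\<open>int_vectors T\<close> is \<open>\<int>\<^sup>T\<close>, a vector being extended by \<open>0\<close> outside \<open>T\<close>.\<close>

definition int_vectors :: "'v set \<Rightarrow> ('v \<Rightarrow> int) set" where
  "int_vectors T = {x. \<forall>t. t \<notin> T \<longrightarrow> x t = 0}"

definition vertex_feasible :: "('v, 'e) ugraph \<Rightarrow> 'v set \<Rightarrow> ('v \<Rightarrow> int) \<Rightarrow> bool" where
  "vertex_feasible G T m \<longleftrightarrow>
     (\<exists>\<P>. (\<forall>P \<in> \<P>. T_path G T P) \<and> pairwise (openly_disjoint T) \<P> \<and>
        (\<forall>t \<in> T. m t = int (card {P \<in> \<P>. is_endpoint G P t})))"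

definition edge_feasible :: "('v, 'e) ugraph \<Rightarrow> 'v set \<Rightarrow> ('v \<Rightarrow> int) \<Rightarrow> bool" where
  "edge_feasible G T m \<longleftrightarrow>
     (\<exists>\<P>. (\<forall>P \<in> \<P>. T_path G T P) \<and> pairwise edge_disjoint \<P> \<and>
        (\<forall>t \<in> T. m t = int (card {P \<in> \<P>. is_endpoint G P t})))"

definition J_vertex :: "('v, 'e) ugraph \<Rightarrow> 'v set \<Rightarrow> ('v \<Rightarrow> int) set" where
  "J_vertex G T = {m \<in> int_vectors T. vertex_feasible G T m}"

definition J_edge :: "('v, 'e) ugraph \<Rightarrow> 'v set \<Rightarrow> ('v \<Rightarrow> int) set" where
  "J_edge G T = {m \<in> int_vectors T. edge_feasible G T m}"

definition unit_vector :: "'v \<Rightarrow> 'v \<Rightarrow> int" where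
  "unit_vector s t = (if t = s then 1 else 0)"

text \<open>\<open>is_step T x y z\<close>: the vector \<open>z\<close> is a step from \<open>x\<close> to \<open>y\<close>.\<close>

definition is_step ::
    "'v set \<Rightarrow> ('v \<Rightarrow> int) \<Rightarrow> ('v \<Rightarrow> int) \<Rightarrow> ('v \<Rightarrow> int) \<Rightarrow> bool" where
  "is_step T x y z \<longleftrightarrow>
     (x = y \<and> z = x) \<or>
     (\<exists>s \<in> T. x s < y s \<and> z = (\<lambda>t. x t + unit_vector s t)) \<or>
     (\<exists>s \<in> T. x s > y s \<and> z = (\<lambda>t. x t - unit_vector s t))"

definition jump_system :: "'v set \<Rightarrow> ('v \<Rightarrow> int) set \<Rightarrow> bool" where
  "jump_system T J \<longleftrightarrow>
     J \<subseteq> int_vectors T \<and>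
     (\<forall>x \<in> J. \<forall>y \<in> J. \<forall>x'. is_step T x y x' \<longrightarrow>
        x' \<in> J \<or> (\<exists>x''. is_step T x' y x'' \<and> x'' \<in> J))"

end

theory Submission
  imports Defs
begin

text \<open>
  Let \<open>S\<close> and \<open>Q\<close> be openly disjoint path systems with vectors \<open>x\<close> and \<open>y\<close>, in a graph without edges
  between terminals, and let \<open>x s < y s\<close>. Some path \<open>q\<close> of \<open>Q\<close> leaves \<open>s\<close> by an edge that \<open>S\<close> does
  not use; follow it to its first vertex \<open>v\<close> that lies on \<open>S\<close> or in \<open>T\<close>. If \<open>v\<close> is an inner vertex of
  a path of \<open>S\<close> from \<open>a\<close> to \<open>b\<close>, replace that path by the one running along \<open>q\<close> from \<open>s\<close> to \<open>v\<close> and on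
  to \<open>a\<close>; this is possible with \<open>a \<noteq> s\<close> and such that the abandoned part from \<open>v\<close> to \<open>b\<close> is not
  contained in \<open>Q\<close>. If \<open>v\<close> is a terminal, add \<open>q\<close>, and if \<open>x v \<ge> y v\<close> drop in exchange a path of \<open>S\<close>
  from \<open>v\<close> to some \<open>b\<close> whose edge at \<open>v\<close> is not in \<open>Q\<close>. In all cases but a pure addition the new
  vector is \<open>x + e\<^sub>s - e\<^sub>b\<close>: either this completes the second step, or \<open>b\<close> is now deficient with respect
  to \<open>y\<close> and the argument is repeated at \<open>b\<close>. It terminates because fewer edges of \<open>S\<close> lie outside
  \<open>Q\<close>. If \<open>x s > y s\<close>, delete a path of \<open>S\<close> whose edge at \<open>s\<close> is not in \<open>Q\<close> and continue at its
  other end.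

  Subdividing all edges puts the vertex-disjoint problem into this form. The edge-disjoint problem is
  the vertex-disjoint one for the line graph, two edges being adjacent when they share a vertex outside
  \<open>T\<close>, with each terminal joined to its incident edges.
\<close>

section \<open>Lists and their links\<close>

definition links :: "'a list \<Rightarrow> ('a \<times> 'a) set" where
  "links p = {(u, v). \<exists>X Y. p = X @ u # v # Y}"

lemma linksI: "(u, v) \<in> links (X @ u # v # Y)"
  by (auto simp: links_def)

lemma links_Nil [simp]: "links [] = {}"
  and links_single [simp]: "links [u] = {}"
  by (auto simp: links_def Cons_eq_append_conv)

lemma links_Cons_Cons [simp]: "links (u # v # p) = insert (u, v) (links (v # p))"
  by (auto simp: links_def Cons_eq_append_conv)

lemma links_append_Cons: "links (X @ v # Y) = links (X @ [v]) \<union> links (v # Y)"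
proof (induction X)
  case (Cons x X)
  then show ?case by (cases X) auto
qed simp

lemma links_rev [simp]: "links (rev p) = (links p)\<inverse>"
proof (induction p)
  case (Cons x p)
  show ?case
  proof (cases p)
    case (Cons y p')
    have "links (rev (x # p)) = links (rev p' @ [y]) \<union> links (y # [x])"
      using links_append_Cons[of "rev p'" y "[x]"] Cons by simp
    then show ?thesis using Cons.IH Cons by auto
  qed simp
qed simp

lemma links_set: "(u, v) \<in> links p \<Longrightarrow> u \<in> set p \<and> v \<in> set p"
  by (auto simp: links_def)

lemma links_Cons_set: "(u, v) \<in> links (x # p) \<Longrightarrow> v \<in> set p"
  by (auto simp: links_def Cons_eq_append_conv)

lemma links_ConsD: "(u, v) \<in> links (x # p) \<Longrightarrow> x \<notin> set p \<Longrightarrow> u = x \<Longrightarrow> p \<noteq> [] \<and> v = hd p"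
  by (cases p) (auto dest: links_set)

lemma links_nth: "(u, v) \<in> links p \<Longrightarrow> \<exists>i. Suc i < length p \<and> u = p ! i \<and> v = p ! Suc i"
proof -
  assume "(u, v) \<in> links p"
  then obtain X Y where "p = X @ u # v # Y" by (auto simp: links_def)
  then show ?thesis by (intro exI[of _ "length X"]) (simp add: nth_append)
qed

definition cnt :: "'a list set \<Rightarrow> 'a \<Rightarrow> int" where
  "cnt R t = int (card {p \<in> R. t \<in> set p})"

text \<open>A system contains each path in one arbitrary orientation; \<open>both\<close> adds the reversed ones.\<close>

definition both :: "'a list set \<Rightarrow> 'a list set" where
  "both R = R \<union> rev ` R"

text \<open>The edges of a system in both directions; symmetric because \<open>both\<close> is
  closed under reversal.\<close>

definition Links :: "'a list set \<Rightarrow> ('a \<times> 'a) set" where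
  "Links R = (\<Union>p \<in> both R. links p)"

lemma both_rev [simp]: "rev p \<in> both R \<longleftrightarrow> p \<in> both R"
  by (auto simp: both_def) (metis imageI rev_rev_ident)

lemma Links_sym: "(u, v) \<in> Links R \<Longrightarrow> (v, u) \<in> Links R"
  unfolding Links_def using both_rev by (metis (no_types, lifting) UN_iff converse_iff links_rev)

section \<open>Openly disjoint path systems\<close>

text \<open>Common frame for both problems. \<open>terminals_stable\<close> gives every T-path an
  inner vertex, so different paths of a system share no edge and are never each other's
  reversal.\<close>

locale terminal_graph =
  fixes A :: "('a \<times> 'a) set" and T :: "'a set"
  assumes finite_A: "finite A"
    and sym_A: "(u, v) \<in> A \<Longrightarrow> (v, u) \<in> A"
    and terminals_stable: "(u, v) \<in> A \<Longrightarrow> u \<in> T \<Longrightarrow> v \<notin> T"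
begin

definition tpath :: "'a list \<Rightarrow> bool" where
  "tpath p \<longleftrightarrow> distinct p \<and> links p \<subseteq> A \<and>
     (\<exists>s ns t. p = s # ns @ [t] \<and> s \<in> T \<and> t \<in> T \<and> set ns \<inter> T = {})"

definition system :: "'a list set \<Rightarrow> bool" where
  "system R \<longleftrightarrow> (\<forall>p \<in> R. tpath p) \<and> (\<forall>p \<in> R. \<forall>q \<in> R. p \<noteq> q \<longrightarrow> set p \<inter> set q \<subseteq> T)"

lemma tpath_rev: "tpath p \<Longrightarrow> tpath (rev p)"
  unfolding tpath_def
proof (elim conjE exE, intro conjI)
  fix s ns t
  assume *: "distinct p" "links p \<subseteq> A" "p = s # ns @ [t]" "s \<in> T" "t \<in> T" "set ns \<inter> T = {}"
  show "distinct (rev p)" using *(1) by simp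
  show "links (rev p) \<subseteq> A" using *(2) sym_A by auto
  show "\<exists>s ns t. rev p = s # ns @ [t] \<and> s \<in> T \<and> t \<in> T \<and> set ns \<inter> T = {}"
    by (rule exI[of _ t], rule exI[of _ "rev ns"], rule exI[of _ s]) (simp add: *)
qed

lemma tpathI:
  assumes "distinct p" "links p \<subseteq> A" "p \<noteq> []" "hd p \<noteq> last p" "hd p \<in> T" "last p \<in> T"
    "set p \<inter> T \<subseteq> {hd p, last p}"
  shows "tpath p"
proof -
  obtain s q where sq: "p = s # q" using assms(3) by (cases p) auto
  obtain ns t where q: "q = ns @ [t]" using sq assms(4) by (cases q rule: rev_cases) auto
  show ?thesis unfolding tpath_def using assms sq q by auto
qed

lemma tpathE:
  assumes "tpath p"
  obtains s w ns t where "p = s # w # ns @ [t]" "s \<in> T" "t \<in> T" "w \<notin> T" "set ns \<inter> T = {}"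
    "distinct p" "links p \<subseteq> A" "s \<noteq> t"
proof -
  from assms obtain s ns t where *: "distinct p" "links p \<subseteq> A" "p = s # ns @ [t]" "s \<in> T" "t \<in> T"
    "set ns \<inter> T = {}" unfolding tpath_def by blast
  show thesis
  proof (cases ns)
    case Nil
    then have "(s, t) \<in> A" using * by auto
    then show ?thesis using terminals_stable * by blast
  next
    case (Cons w ms)
    show ?thesis by (rule that[of s w ms t]) (use * Cons in auto)
  qed
qed

lemma tpath_ends:
  assumes "tpath p" "t \<in> T"
  shows "t \<in> set p \<longleftrightarrow> t = hd p \<or> t = last p"
  using assms by (elim tpathE) auto

lemma tpath_hd_last:
  assumes "tpath p"
  shows "hd p \<in> T" "last p \<in> T" "hd p \<noteq> last p" "p \<noteq> []" "distinct p" "links p \<subseteq> A"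
  using assms by (elim tpathE, auto)+

lemma tpath_not_subset: "tpath p \<Longrightarrow> \<not> set p \<subseteq> T"
  by (elim tpathE) auto

lemma tpath_indicator:
  assumes "tpath p" "t \<in> T"
  shows "of_bool (t \<in> set p) = unit_vector (hd p) t + unit_vector (last p) t"
  using tpath_ends[OF assms] tpath_hd_last(3)[OF assms(1)] by (auto simp: unit_vector_def)

lemma both_tpath: "system R \<Longrightarrow> p \<in> both R \<Longrightarrow> tpath p"
  by (auto simp: both_def system_def tpath_rev)

lemma both_unique:
  assumes "system R" "p \<in> both R" "q \<in> both R" "v \<in> set p" "v \<in> set q" "v \<notin> T"
  shows "q = p \<or> q = rev p"
proof -
  have *: "p' = q'" if "p' \<in> R" "q' \<in> R" "v \<in> set p'" "v \<in> set q'" for p' q'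
    using assms(1,6) that unfolding system_def by blast
  from assms(2,3) show ?thesis
    unfolding both_def using assms(4,5) *
    by (metis UnE imageE rev_rev_ident set_rev)
qed

text \<open>A T-path is a repetition-free list over the finitely many vertices incident with
  \<open>A\<close>.\<close>

lemma finite_system:
  assumes "system R" shows "finite R"
proof -
  let ?W = "fst ` A \<union> snd ` A"
  have fin: "finite ?W" using finite_A by simp
  have "set p \<subseteq> ?W \<and> length p \<le> card ?W" if "p \<in> R" for p
  proof -
    have tp: "tpath p" using assms that by (auto simp: system_def)
    have "set p \<subseteq> ?W"
    proof
      fix x assume x: "x \<in> set p"
      then obtain X Y where p: "p = X @ x # Y" by (meson split_list)
      have l: "links p \<subseteq> A" using tp by (rule tpath_hd_last)
      show "x \<in> ?W"
      proof (cases Y)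
        case (Cons y Y')
        then have "(x, y) \<in> links p" using p by (auto simp: links_def)
        then show ?thesis using l by force
      next
        case Nil
        have "X \<noteq> []" using tpath_hd_last(3)[OF tp] p Nil by auto
        then obtain X' y where "X = X' @ [y]" by (meson rev_exhaust)
        then have "(y, x) \<in> links p" using p by (auto simp: links_def)
        then show ?thesis using l by force
      qed
    qed
    then show ?thesis
      using fin tpath_hd_last(5)[OF tp] by (metis card_mono distinct_card)
  qed
  then have "R \<subseteq> {p. set p \<subseteq> ?W \<and> length p \<le> card ?W}" by blast
  then show ?thesis by (rule finite_subset) (rule finite_lists_length_le[OF fin])
qed

section \<open>Links at inner vertices and at terminals\<close>

lemma Links_subset: "system R \<Longrightarrow> Links R \<subseteq> A"
  using tpath_hd_last(6) both_tpath unfolding Links_def by blast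

text \<open>Up to reversal an inner vertex lies on only one path of the system, so every link
  leaving it comes from that path.\<close>

lemma Links_path:
  assumes "system R" "p \<in> both R" "(u, v) \<in> Links R" "u \<in> set p" "u \<notin> T"
  shows "(u, v) \<in> links p \<union> links (rev p)"
proof -
  obtain q where q: "q \<in> both R" "(u, v) \<in> links q" using assms(3) by (auto simp: Links_def)
  then have "q = p \<or> q = rev p"
    using both_unique assms links_set by metis
  then show ?thesis using q by blast
qed

text \<open>A terminal occurs on a T-path only as an end, so a link leaving it is the first one of
  the path in a suitable orientation.\<close>

lemma Links_terminal:
  assumes "system R" "(t, w) \<in> Links R" "t \<in> T"
  obtains q where "t # w # q \<in> both R"
proof -
  obtain p where p: "p \<in> both R" "(t, w) \<in> links p" using assms(2) by (auto simp: Links_def)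
  from both_tpath[OF assms(1) p(1)] obtain s ns t' where *:
    "distinct p" "p = s # ns @ [t']" "set ns \<inter> T = {}"
    unfolding tpath_def by blast
  have "t = s \<or> t = t'" using links_set[OF p(2)] * assms(3) by auto
  moreover have "t \<noteq> t'"
  proof -
    obtain X Y where XY: "p = X @ t # w # Y" using p(2) by (auto simp: links_def)
    then have "last p \<in> set (w # Y)" by simp
    moreover have "t \<notin> set (w # Y)" using XY *(1) by auto
    ultimately show ?thesis using *(2) by auto
  qed
  ultimately have "t = s" by blast
  then have "ns @ [t'] \<noteq> [] \<and> w = hd (ns @ [t'])" using links_ConsD[of t w s "ns @ [t']"] p(2) * by auto
  then have "p = t # w # tl (ns @ [t'])" using * \<open>t = s\<close> by (metis list.collapse)
  then show thesis using p(1) that by blast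
qed

text \<open>Each path at \<open>t\<close> has one link leaving \<open>t\<close>, and different paths
  have different ones because the neighbour of \<open>t\<close> is an inner vertex. Comparing two
  systems at \<open>t\<close> thus becomes comparing two finite sets of neighbours.\<close>

lemma cnt_eq_card_Links:
  assumes R: "system R" and t: "t \<in> T"
  shows "cnt R t = int (card {w. (t, w) \<in> Links R})"
proof -
  \<comment> \<open>\<open>f p\<close> is the neighbour of \<open>t\<close> on \<open>p\<close>,
    whichever end of \<open>p\<close> the terminal \<open>t\<close> is.\<close>
  define f where "f p = (if hd p = t then p ! 1 else rev p ! 1)" for p
  have f: "(f p \<in> set p \<and> f p \<notin> T) \<and> (\<exists>q. t # f p # q \<in> {p, rev p})"
    if "p \<in> R" "t \<in> set p" for p
  proof -
    have tp: "tpath p" using R that by (auto simp: system_def)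
    show ?thesis
    proof (cases "hd p = t")
      case True
      then show ?thesis using tp by (elim tpathE) (auto simp: f_def)
    next
      case False
      then have "hd (rev p) = t" using tpath_ends[OF tp t] that by (simp add: hd_rev)
      then show ?thesis using tpath_rev[OF tp] False
        by (elim tpathE) (auto simp: f_def simp flip: set_rev[of p])
    qed
  qed
  have "bij_betw f {p \<in> R. t \<in> set p} {w. (t, w) \<in> Links R}"
  proof (rule bij_betw_imageI)
    show "inj_on f {p \<in> R. t \<in> set p}"
    proof (rule inj_onI)
      fix p p' assume "p \<in> {p \<in> R. t \<in> set p}" "p' \<in> {p \<in> R. t \<in> set p}" "f p = f p'"
      then have "p \<in> R" "p' \<in> R" "f p \<in> set p \<inter> set p'" "f p \<notin> T" using f[of p] f[of p'] by auto
      then show "p = p'" using R unfolding system_def by blast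
    qed
    show "f ` {p \<in> R. t \<in> set p} = {w. (t, w) \<in> Links R}"
    proof safe
      fix p assume p: "p \<in> R" "t \<in> set p"
      then obtain q where q: "t # f p # q \<in> {p, rev p}" using f by blast
      then have "t # f p # q \<in> both R" using p by (auto simp: both_def)
      then show "(t, f p) \<in> Links R" unfolding Links_def by force
    next
      fix w assume "(t, w) \<in> Links R"
      then obtain q where q: "t # w # q \<in> both R" using Links_terminal R t by blast
      then obtain p where p: "p \<in> R" "p = t # w # q \<or> rev p = t # w # q"
        unfolding both_def by (metis UnE imageE)
      have tp: "tpath p" using R p(1) by (auto simp: system_def)
      have "t \<in> set p" using p(2) by (metis list.set_intros(1) set_rev)
      moreover have "f p = w"
      proof (cases "hd p = t")
        case True
        have "rev p \<noteq> t # w # q"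
        proof
          assume "rev p = t # w # q"
          then have "hd (rev p) = t" by simp
          then show False using True tpath_hd_last(3)[OF tp] by (simp add: hd_rev)
        qed
        then show ?thesis using p(2) True by (auto simp: f_def)
      next
        case False
        then show ?thesis using p(2) by (auto simp: f_def)
      qed
      ultimately show "w \<in> f ` {p \<in> R. t \<in> set p}" using p by blast
    qed
  qed
  then show ?thesis unfolding cnt_def by (simp add: bij_betw_same_card)
qed

lemma finite_neighbours: "system R \<Longrightarrow> finite {w. (t, w) \<in> Links R}"
  by (rule finite_subset[of _ "snd ` A"]) (use Links_subset finite_A in force)+

section \<open>Adding and removing a single path\<close>

lemma system_add:
  assumes "system R" "tpath p" "\<And>q. q \<in> R \<Longrightarrow> set p \<inter> set q \<subseteq> T"
  shows "system (insert p R)"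
    and "t \<in> T \<Longrightarrow> cnt (insert p R) t = cnt R t + (unit_vector (hd p) t + unit_vector (last p) t)"
    and "Links (insert p R) = Links R \<union> links p \<union> links (rev p)"
proof -
  show "system (insert p R)" using assms by (auto simp: system_def)
  have "p \<notin> R" using assms(3)[of p] tpath_not_subset[OF assms(2)] by auto
  moreover have "{q \<in> insert p R. t \<in> set q} =
      (if t \<in> set p then insert p {q \<in> R. t \<in> set q} else {q \<in> R. t \<in> set q})" by auto
  ultimately have "cnt (insert p R) t = cnt R t + of_bool (t \<in> set p)"
    using finite_system[OF assms(1)] by (auto simp: cnt_def)
  then show "cnt (insert p R) t = cnt R t + (unit_vector (hd p) t + unit_vector (last p) t)"
    if "t \<in> T" using tpath_indicator[OF assms(2) that] by simp
  show "Links (insert p R) = Links R \<union> links p \<union> links (rev p)"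
    by (auto simp: Links_def both_def)
qed

lemma system_remove:
  assumes R: "system R" and p: "p \<in> both R" and R': "R' = R - {p, rev p}"
  shows "system R'"
    and "t \<in> T \<Longrightarrow> cnt R' t = cnt R t - (unit_vector (hd p) t + unit_vector (last p) t)"
    and "Links R' \<subseteq> Links R - links p"
    and "q \<in> R' \<Longrightarrow> set p \<inter> set q \<subseteq> T"
proof -
  obtain p' where p': "p' \<in> R" "p' = p \<or> p' = rev p"
    using p by (auto simp: both_def)
  have sub: "set p' = set p" using p' by auto
  have tp: "tpath p'" "tpath p" using R p' both_tpath p by (auto simp: system_def)
  show d: "set p \<inter> set q \<subseteq> T" if "q \<in> R'" for q
    using R p' sub that unfolding R' system_def by blast
  show S': "system R'" using R R' by (auto simp: system_def)
  have "p' \<notin> R'" using p' R' by auto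
  \<comment> \<open>Only one of \<open>p\<close> and \<open>rev p\<close> is in \<open>R\<close>:
    they have the same vertices, not all of which are terminals. The count then follows by adding
    \<open>p'\<close> back.\<close>
  have 1: "R = insert p' R'"
  proof
    have "x \<in> insert p' R'" if "x \<in> R" for x
    proof (rule ccontr)
      assume n: "x \<notin> insert p' R'"
      then have "x = p \<or> x = rev p" and ne: "x \<noteq> p'" using that unfolding R' by simp_all
      then have "set x = set p'" using sub by (metis set_rev)
      then have "set x \<subseteq> T" using R p' that ne unfolding system_def by blast
      moreover have "tpath x" using R that by (auto simp: system_def)
      ultimately show False using tpath_not_subset by blast
    qed
    then show "R \<subseteq> insert p' R'" by blast
  qed (use p' R' in auto)
  have "cnt R t = cnt R' t + (unit_vector (hd p') t + unit_vector (last p') t)" if "t \<in> T"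
    using system_add(2)[OF S' tp(1)] d sub 1 that by simp
  then show "cnt R' t = cnt R t - (unit_vector (hd p) t + unit_vector (last p) t)" if "t \<in> T"
    using p'(2) that by (auto simp: hd_rev last_rev)
  show "Links R' \<subseteq> Links R - links p"
  proof -
    \<comment> \<open>A surviving link of \<open>p\<close> would join two vertices common to
      \<open>p\<close> and another path, hence two terminals.\<close>
    have "False" if "(u, v) \<in> Links R'" "(u, v) \<in> links p" for u v
    proof -
      obtain q where q: "q \<in> both R'" "(u, v) \<in> links q" using \<open>(u, v) \<in> Links R'\<close> by (auto simp: Links_def)
      then obtain q' where "q' \<in> R'" "set q' = set q" by (auto simp: both_def)
      then have "u \<in> T" "v \<in> T" using d[of q'] links_set[OF that(2)] links_set[OF q(2)] by auto
      moreover have "(u, v) \<in> A" using that(2) tpath_hd_last(6)[OF tp(2)] by blast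
      ultimately show False using terminals_stable by blast
    qed
    moreover have "Links R' \<subseteq> Links R" by (auto simp: Links_def both_def R')
    ultimately show ?thesis by auto
  qed
qed

section \<open>Second steps and the exchange argument\<close>

text \<open>Here \<open>z\<close> is the vector after the first step, and \<open>R\<close> realizes
  a second step towards the vector of \<open>Q\<close>. Each path adds 2 to the coordinate sum, so a
  vector one unit away from that of a system is never realized itself, and a second step is what has
  to be found.\<close>

definition steppable :: "'a list set \<Rightarrow> ('a \<Rightarrow> int) \<Rightarrow> bool" where
  "steppable Q z \<longleftrightarrow> (\<exists>R u. system R \<and> u \<in> T \<and>
     (z u < cnt Q u \<and> (\<forall>t \<in> T. cnt R t = z t + unit_vector u t) \<or>
      z u > cnt Q u \<and> (\<forall>t \<in> T. cnt R t = z t - unit_vector u t)))"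

lemma steppable_cong:
  assumes "\<And>t. t \<in> T \<Longrightarrow> z t = z' t" "steppable Q z"
  shows "steppable Q z'"
  using assms unfolding steppable_def by metis

text \<open>Either the drop at \<open>b\<close> is itself the second step, or \<open>S'\<close> is deficient at \<open>b\<close>.\<close>

lemma steppable_release:
  assumes "system S'" "b \<in> T" and cnt: "\<And>t. t \<in> T \<Longrightarrow> cnt S' t = z t - unit_vector b t"
    and continue: "cnt S' b < cnt Q b \<Longrightarrow> steppable Q (\<lambda>t. cnt S' t + unit_vector b t)"
  shows "steppable Q z"
proof (cases "z b > cnt Q b")
  case True
  then show ?thesis unfolding steppable_def using assms(1,2) cnt by blast
next
  case False
  then have "cnt S' b < cnt Q b" using cnt[OF assms(2)] by (simp add: unit_vector_def)
  from continue[OF this] show ?thesis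
    by (rule steppable_cong[rotated]) (simp add: cnt)
qed

text \<open>The measure of the induction in \<open>steppable_add\<close> falls because an exchange
  brings in only links of \<open>Q\<close> and loses the link \<open>l\<close> outside
  \<open>Q\<close>.\<close>

lemma card_Links_less:
  assumes "system S" "l \<in> Links S" "l \<notin> Links Q" "Links S' \<subseteq> Links Q \<union> (Links S - {l})"
  shows "card (Links S' - Links Q) < card (Links S - Links Q)"
proof (rule psubset_card_mono)
  show "finite (Links S - Links Q)"
    using Links_subset[OF assms(1)] finite_A by (meson finite_Diff finite_subset)
  show "Links S' - Links Q \<subset> Links S - Links Q" using assms(2-4) by blast
qed

text \<open>At an inner vertex of \<open>q\<close> every link of \<open>Q\<close> belongs to
  \<open>q\<close>, so the walk stays on \<open>q\<close>. What is extracted is its last but one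
  vertex \<open>w\<close>.\<close>

lemma common_walk_inside:
  assumes "system Q" "q \<in> both Q" "v \<in> set q" "v \<notin> T" "links (v # B) \<subseteq> Links Q"
    "set (butlast B) \<inter> T = {}" "B \<noteq> []"
  shows "\<exists>w X. w \<in> set q \<and> w \<notin> T \<and> v # B = X @ [w, last B]"
  using assms(3-)
proof (induction B arbitrary: v)
  case (Cons c B)
  show ?case
  proof (cases "B = []")
    case True
    then show ?thesis using Cons.prems by (intro exI[of _ v] exI[of _ "[]"]) auto
  next
    case False
    have "(v, c) \<in> Links Q" using Cons.prems by simp
    then have "c \<in> set q"
      using Links_path[OF assms(1,2)] Cons.prems(1,2) links_set by fastforce
    moreover have "c \<notin> T" "set (butlast B) \<inter> T = {}" using Cons.prems(4) False by auto
    ultimately obtain w X where "w \<in> set q" "w \<notin> T" "c # B = X @ [w, last B]"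
      using Cons.IH[of c] Cons.prems False by auto
    then show ?thesis using False by (intro exI[of _ w] exI[of _ "v # X"]) auto
  qed
qed simp

text \<open>
  Makes the rerouting possible: the part of an \<open>S\<close>-path beyond \<open>v\<close> can lie inside \<open>Q\<close> only in the
  direction that leads to the far end of \<open>q\<close>, hence in at most one direction, and never towards \<open>s\<close>.
\<close>

lemma common_walk_end:
  assumes S: "system S" and Q: "system Q" and p: "p \<in> both S" "p = X @ v # B"
    and q: "q \<in> both Q" "q = s # w # q'" and "(s, w) \<notin> Links S"
    and v: "v \<in> set q" "v \<notin> T" and "links (v # B) \<subseteq> Links Q"
  shows "last B = last q"
proof -
  have tp: "tpath p" and tq: "tpath q" using both_tpath S Q p q by blast+
  obtain a ns b where ab: "p = a # ns @ [b]" "set ns \<inter> T = {}" "a \<in> T" "b \<in> T"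
    using tp unfolding tpath_def by blast
  have "B \<noteq> []" using p(2) ab v(2) by (cases B rule: rev_cases) auto
  then obtain B' where B': "B = B' @ [b]" using p(2) ab
    by (metis append_butlast_last_id last.simps last_ConsR last_appendR list.distinct(1) snoc_eq_iff_butlast)
  have "X \<noteq> []" using p(2) ab v(2) by auto
  then have "set B' \<subseteq> set ns" using p(2) ab(1) B' by (cases X) auto
  then have "set (butlast B) \<inter> T = {}" using B' ab(2) by auto
  then obtain u Z where u: "u \<in> set q" "u \<notin> T" "v # B = Z @ [u, last B]"
    using common_walk_inside[OF Q q(1) v assms(10)] \<open>B \<noteq> []\<close> by blast
  have "(u, last B) \<in> links (v # B)" unfolding u(3) by (auto simp: links_def)
  then have uQ: "(u, last B) \<in> Links Q" and "(u, last B) \<in> links p"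
    using assms(10) p(2) links_append_Cons[of X v B] by auto
  then have "(u, last B) \<in> Links S" using p(1) unfolding Links_def by blast
  then have uS: "(last B, u) \<in> Links S" by (rule Links_sym)
  \<comment> \<open>The link into the terminal \<open>last B\<close> is shared with
    \<open>q\<close>, so \<open>last B\<close> is an end of \<open>q\<close>; it remains to rule out
    \<open>s\<close>.\<close>
  have ul: "(u, last B) \<in> links q \<union> links (rev q)" using Links_path[OF Q q(1) uQ u(1,2)] .
  then have "last B \<in> set q" using links_set by fastforce
  moreover have "last B \<in> T" using B' ab by simp
  \<comment> \<open>The only neighbour of \<open>s\<close> on \<open>q\<close> is \<open>w\<close>,
    so otherwise \<open>u = w\<close> and \<open>S\<close> would use the link
    \<open>(s, w)\<close>.\<close>
  moreover have "last B \<noteq> s"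
  proof
    assume eq: "last B = s"
    have "distinct q" using tq by (rule tpath_hd_last)
    then have "(u, s) \<notin> links q" using q(2) links_Cons_set[of u s s "w # q'"] by auto
    then have "(s, u) \<in> links q" using ul eq by auto
    then have "u = w" using q(2) links_ConsD[of s u s "w # q'"] \<open>distinct q\<close> by auto
    then show False using uS eq assms(7) by simp
  qed
  ultimately show ?thesis using tpath_ends[OF tq, of "last B"] q(2) by simp
qed

text \<open>The new path \<open>r\<close> follows \<open>q\<close> from its start to
  \<open>v\<close> and then \<open>p\<close> backwards to \<open>hd p\<close>. So
  \<open>hd p\<close> keeps its count, \<open>hd q\<close> gains and \<open>last p\<close> loses
  one. The links taken from \<open>q\<close> are in \<open>Q\<close>, and \<open>l\<close>
  disappears with the abandoned part of \<open>p\<close>.\<close>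

lemma reroute:
  assumes S: "system S" and Q: "system Q" and p: "p \<in> both S" "p = X @ v # B"
    and q: "q \<in> both Q" "q = C @ v # D" and v: "v \<notin> T"
    and C: "\<And>r. r \<in> S \<Longrightarrow> set C \<inter> set r \<subseteq> T"
    and neq: "hd p \<noteq> hd q" and l: "l \<in> links (v # B)" "l \<notin> Links Q"
  obtains S' where "system S'"
    "\<And>t. t \<in> T \<Longrightarrow> cnt S' t = cnt S t + unit_vector (hd q) t - unit_vector (last p) t"
    "card (Links S' - Links Q) < card (Links S - Links Q)"
proof -
  have tp: "tpath p" and tq: "tpath q" using both_tpath S Q p q by blast+
  have dp: "distinct p" and dq: "distinct q" using tpath_hd_last tp tq by blast+
  define S0 where "S0 = S - {p, rev p}"
  note S0 = system_remove[OF S p(1) S0_def]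
  define r where "r = C @ v # rev X"
  have "X \<noteq> []" using p(2) v tpath_hd_last(1)[OF tp] by auto
  have "C \<noteq> []" using q(2) v tpath_hd_last(1)[OF tq] by auto
  have "B \<noteq> []" using p(2) v tpath_hd_last(2)[OF tp] by auto
  have "D \<noteq> []" using q(2) v tpath_hd_last(2)[OF tq] by auto
  obtain X' where X': "X = hd p # X'" using \<open>X \<noteq> []\<close> p(2) by (cases X) auto
  obtain C' where C': "C = hd q # C'" using \<open>C \<noteq> []\<close> q(2) by (cases C) auto
  have TX: "set X \<inter> T = {hd p}"
  proof -
    have "last p \<notin> set X" using dp p(2) \<open>B \<noteq> []\<close> by auto
    moreover have "x \<in> {hd p, last p}" if "x \<in> set X" "x \<in> T" for x
      using tpath_ends[OF tp, of x] that p(2) by auto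
    ultimately show ?thesis using X' tpath_hd_last(1)[OF tp] by auto
  qed
  have TC: "set C \<inter> T = {hd q}"
  proof -
    have "last q \<notin> set C" using dq q(2) \<open>D \<noteq> []\<close> by auto
    moreover have "x \<in> {hd q, last q}" if "x \<in> set C" "x \<in> T" for x
      using tpath_ends[OF tq, of x] that q(2) by auto
    ultimately show ?thesis using C' tpath_hd_last(1)[OF tq] by auto
  qed
  have inside: "x \<notin> T" if "Z = z # Z'" "set Z \<inter> T = {z}" "z \<notin> set Z'" "x \<in> set Z'" for Z z Z' x
  proof
    assume "x \<in> T"
    then have "x \<in> set Z \<inter> T" using that(1,4) by simp
    then have "x = z" unfolding that(2) by simp
    then show False using that(3,4) by simp
  qed
  obtain r0 where "r0 \<in> S" "set r0 = set p" using p(1) by (auto simp: both_def)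
  then have Cp: "set C \<inter> set p \<subseteq> T" using C[of r0] by simp
  have links_r: "links r = links (C @ [v]) \<union> (links (X @ [v]))\<inverse>"
    using links_append_Cons[of C v "rev X"] links_rev[of "X @ [v]"] by (simp add: r_def)
  have CQ: "links (C @ [v]) \<subseteq> links q" using links_append_Cons[of C v D] q(2) by simp
  have Xp: "links (X @ [v]) \<subseteq> links p" using links_append_Cons[of X v B] p(2) by simp
  have tr: "tpath r"
    unfolding tpath_def
  proof (intro conjI)
    \<comment> \<open>A common vertex of \<open>C\<close> and \<open>X\<close> would be a terminal,
      hence equal to both \<open>hd p\<close> and \<open>hd q\<close>.\<close>
    have "x \<notin> set X" if "x \<in> set C" for x
    proof
      assume "x \<in> set X"
      then have "x \<in> T" using that Cp p(2) by auto
      then have "x = hd p" "x = hd q" using TX TC that \<open>x \<in> set X\<close> by blast+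
      then show False using neq by simp
    qed
    moreover have "distinct X" "v \<notin> set X" "distinct C" "v \<notin> set C" using dp dq unfolding p(2) q(2) by auto
    ultimately show "distinct r" unfolding r_def by auto
    show "links r \<subseteq> A"
      using links_r CQ Xp tpath_hd_last(6)[OF tp] tpath_hd_last(6)[OF tq] sym_A by auto
    show "\<exists>s ns t. r = s # ns @ [t] \<and> s \<in> T \<and> t \<in> T \<and> set ns \<inter> T = {}"
    proof (intro exI conjI)
      show "r = hd q # (C' @ v # rev X') @ [hd p]" using X' C' by (simp add: r_def)
      have "hd q \<notin> set C'" using C' q(2) dq by (metis distinct.simps(2) distinct_append)
      moreover have "hd p \<notin> set X'" using X' p(2) dp by (metis distinct.simps(2) distinct_append)
      ultimately show "set (C' @ v # rev X') \<inter> T = {}"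
        using inside[OF C' TC] inside[OF X' TX] v by auto
    qed (use tpath_hd_last tp tq in auto)
  qed
  have disj: "set r \<inter> set r' \<subseteq> T" if "r' \<in> S0" for r'
    using that C[of r'] S0(4)[OF that] p(2) by (auto simp: r_def S0_def)
  note S' = system_add[OF S0(1) tr disj]
  have hr: "hd r = hd q" "last r = hd p" using C' X' by (auto simp: r_def)
  show thesis
  proof (rule that)
    show "system (insert r S0)" by (rule S'(1))
    show "cnt (insert r S0) t = cnt S t + unit_vector (hd q) t - unit_vector (last p) t"
      if "t \<in> T" for t using S'(2) S0(2) that hr by simp
    have lp: "l \<in> links p" using l(1) p(2) links_append_Cons[of X v B] by simp
    show "card (Links (insert r S0) - Links Q) < card (Links S - Links Q)"
    proof (rule card_Links_less[OF S])
      show "l \<in> Links S" using p(1) lp by (auto simp: Links_def)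
      show "l \<notin> Links Q" by fact
      have "links (C @ [v]) \<subseteq> Links Q" using CQ q(1) unfolding Links_def by blast
      then have "links (C @ [v]) \<union> (links (C @ [v]))\<inverse> \<subseteq> Links Q"
        using Links_sym[of _ _ Q] by auto
      moreover have "links (X @ [v]) \<subseteq> Links S" using Xp p(1) unfolding Links_def by blast
      then have "links (X @ [v]) \<union> (links (X @ [v]))\<inverse> \<subseteq> Links S"
        using Links_sym[of _ _ S] by auto
      \<comment> \<open>The second vertex of \<open>l\<close> is in \<open>B\<close>, so
        \<open>l\<close> is in neither direction a link of the part of \<open>p\<close> that is
        kept.\<close>
      moreover have "l \<notin> links (X @ [v]) \<union> (links (X @ [v]))\<inverse>"
      proof -
        obtain l1 l2 where l12: "l = (l1, l2)" by (cases l)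
        then have "l2 \<in> set B" using l(1) links_Cons_set by metis
        then have "l2 \<notin> set (X @ [v])" using dp p(2) by auto
        then show ?thesis using l12 links_set[of _ _ "X @ [v]"] by blast
      qed
      ultimately show "Links (insert r S0) \<subseteq> Links Q \<union> (Links S - {l})"
        using S'(3) S0(3) lp links_r by auto
    qed
  qed
qed

lemma steppable_add:
  assumes S: "system S" and Q: "system Q" and s: "s \<in> T" "cnt S s < cnt Q s"
  shows "steppable Q (\<lambda>t. cnt S t + unit_vector s t)"
  using S s
proof (induction "card (Links S - Links Q)" arbitrary: S s rule: less_induct)
  case less
  note S = \<open>system S\<close>
  let ?z = "\<lambda>t. cnt S t + unit_vector s t"
  \<comment> \<open>Closes every exchange: either the drop at \<open>b\<close> is the second step,
    or the induction hypothesis applies to \<open>S'\<close> at \<open>b\<close>. The case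
    \<open>b = s\<close> is included.\<close>
  have release: "steppable Q ?z"
    if "system S'" "b \<in> T" "\<And>t. t \<in> T \<Longrightarrow> cnt S' t = cnt S t + unit_vector s t - unit_vector b t"
      "card (Links S' - Links Q) < card (Links S - Links Q)" for S' b
    by (rule steppable_release[of S' b]) (use that less.hyps[of S' b] in auto)
  have "\<not> {w. (s, w) \<in> Links Q} \<subseteq> {w. (s, w) \<in> Links S}"
    using less.prems(3) card_mono[OF finite_neighbours[OF S, of s], of "{w. (s, w) \<in> Links Q}"]
    unfolding cnt_eq_card_Links[OF S less.prems(2)] cnt_eq_card_Links[OF Q less.prems(2)] by linarith
  then obtain w where w: "(s, w) \<in> Links Q" "(s, w) \<notin> Links S" by blast
  obtain q' where q: "s # w # q' \<in> both Q" by (rule Links_terminal[OF Q w(1) less.prems(2)])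
  define q where "q = s # w # q'"
  have tq: "tpath q" using both_tpath[OF Q q] by (simp add: q_def)
  \<comment> \<open>The search along \<open>q\<close> stops at a terminal or at a vertex of
    \<open>S\<close>; it does stop, because \<open>q\<close> ends in a terminal.\<close>
  define hit where "hit x \<longleftrightarrow> x \<in> T \<or> (\<exists>r \<in> S. x \<in> set r)" for x
  have "\<exists>x \<in> set (w # q'). hit x" using tpath_hd_last(2)[OF tq] by (auto simp: q_def hit_def split: if_splits)
  then obtain C' v D where C': "w # q' = C' @ v # D" "hit v" "\<forall>x \<in> set C'. \<not> hit x"
    by (metis split_list_first_prop)
  define C where "C = s # C'"
  have qC: "q = C @ v # D" using C' by (simp add: q_def C_def)
  have CS: "set C \<inter> set r \<subseteq> T" if "r \<in> S" for r
    using C'(3) that less.prems(2) by (auto simp: C_def hit_def)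
  show ?case
  proof (cases "v \<in> T")
    case True
    have "v = last q" "v \<noteq> s"
      using tpath_ends[OF tq True] qC tpath_hd_last(5)[OF tq] by (auto simp: C_def)
    \<comment> \<open>As a terminal other than \<open>s\<close>, \<open>v\<close> is the last vertex
      of \<open>q\<close>, so \<open>q\<close> meets \<open>S\<close> only in terminals and can be
      added as a whole.\<close>
    then have "D = []" using qC tpath_hd_last(5)[OF tq] by (cases D rule: rev_cases) auto
    have disj: "set q \<inter> set r \<subseteq> T" if "r \<in> S" for r using CS[OF that] qC \<open>D = []\<close> True by auto
    note hq = \<open>v = last q\<close>[symmetric]
    have hd_q: "hd q = s" by (simp add: q_def)
    show ?thesis
    proof (cases "cnt S v < cnt Q v")
      case less: True
      \<comment> \<open>Adding \<open>q\<close> performs both steps, at \<open>s\<close> and at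
        \<open>v\<close>.\<close>
      show ?thesis unfolding steppable_def
      proof (intro exI conjI disjI1 ballI)
        show "system (insert q S)" by (rule system_add[OF S tq disj])
        show "cnt (insert q S) t = cnt S t + unit_vector s t + unit_vector v t" if "t \<in> T" for t
          using system_add(2)[OF S tq disj that] hq hd_q by simp
        show "cnt S v + unit_vector s v < cnt Q v" using less \<open>v \<noteq> s\<close> by (simp add: unit_vector_def)
      qed fact
    next
      case False
      obtain w' where w': "(v, w') \<in> links (rev q)" "w' \<in> set C"
      proof -
        obtain u where u: "C = butlast C @ [u]" by (metis C_def append_butlast_last_id list.distinct(1))
        then have "q = butlast C @ u # v # []" using qC \<open>D = []\<close> by (metis append_Cons append_assoc append_Nil)
        then have "(u, v) \<in> links q" using linksI by metis
        then show thesis using that[of u] u by (metis converse_iff in_set_conv_decomp links_rev)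
      qed
      have w'Q: "(v, w') \<in> Links Q" using w'(1) q unfolding Links_def q_def using both_rev by blast
      \<comment> \<open>If \<open>S\<close> had this link, \<open>w'\<close> would be an inner
        vertex of \<open>S\<close> on \<open>C\<close>, where \<open>q\<close> meets
        \<open>S\<close> only in terminals.\<close>
      have w'S: "(v, w') \<notin> Links S"
      proof
        assume vw: "(v, w') \<in> Links S"
        then obtain r0 where r0: "r0 \<in> both S" "(v, w') \<in> links r0" unfolding Links_def by blast
        then obtain r where "r \<in> S" "set r = set r0" unfolding both_def by auto
        then have "r \<in> S" "w' \<in> set r" using links_set[OF r0(2)] by auto
        moreover have "w' \<notin> T" using vw Links_subset[OF S] terminals_stable True by blast
        ultimately show False using CS w'(2) by blast
      qed
      \<comment> \<open>\<open>S\<close> has at least as many links at \<open>v\<close> as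
        \<open>Q\<close> but misses one of \<open>Q\<close>, so it has one outside \<open>Q\<close>;
        the path with that link is given up for \<open>q\<close>.\<close>
      have "\<not> {u. (v, u) \<in> Links S} \<subseteq> {u. (v, u) \<in> Links Q}"
      proof
        assume "{u. (v, u) \<in> Links S} \<subseteq> {u. (v, u) \<in> Links Q}"
        then have "{u. (v, u) \<in> Links S} \<subset> {u. (v, u) \<in> Links Q}" using w'Q w'S by blast
        then have "card {u. (v, u) \<in> Links S} < card {u. (v, u) \<in> Links Q}"
          using finite_neighbours[OF Q] psubset_card_mono by blast
        then show False using False by (simp add: cnt_eq_card_Links S Q True)
      qed
      then obtain u where u: "(v, u) \<in> Links S" "(v, u) \<notin> Links Q" by blast
      obtain p' where p': "v # u # p' \<in> both S" by (rule Links_terminal[OF S u(1) True])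
      define p where "p = v # u # p'"
      have p: "p \<in> both S" "(v, u) \<in> links p" using p' by (auto simp: p_def)
      define S0 where "S0 = S - {p, rev p}"
      note S0 = system_remove[OF S p(1) S0_def]
      have disj0: "set q \<inter> set r \<subseteq> T" if "r \<in> S0" for r using disj that by (auto simp: S0_def)
      note S' = system_add[OF S0(1) tq disj0]
      show ?thesis
      proof (rule release)
        show "system (insert q S0)" by (rule S'(1))
        show "last p \<in> T" using tpath_hd_last(2) both_tpath[OF S p(1)] .
        show "cnt (insert q S0) t = cnt S t + unit_vector s t - unit_vector (last p) t"
          if "t \<in> T" for t
          using S'(2)[of t] S0(2)[of t] that hq hd_q by (simp add: p_def)
        show "card (Links (insert q S0) - Links Q) < card (Links S - Links Q)"
        proof (rule card_Links_less[OF S u])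
          have "links q \<union> links (rev q) \<subseteq> Links Q"
            using q both_rev unfolding Links_def q_def by blast
          then show "Links (insert q S0) \<subseteq> Links Q \<union> (Links S - {(v, u)})"
            using S'(3) S0(3) p(2) by auto
        qed
      qed
    qed
  next
    case False
    then obtain p where p: "p \<in> both S" "v \<in> set p" using C'(2) by (auto simp: hit_def both_def)
    then obtain X B where pX: "p = X @ v # B" by (meson split_list)
    have tp: "tpath p" using both_tpath[OF S p(1)] .
    have hd_q: "hd q = s" by (simp add: q_def)
    have rp: "rev p \<in> both S" "rev p = rev B @ v # rev X" using p(1) by (simp_all add: pX[symmetric]) (simp add: pX)
    have vq: "v \<in> set q" using qC by simp
    have qQ: "q \<in> both Q" using q by (simp add: q_def)
    have ne: "X \<noteq> []" "B \<noteq> []" using pX False tpath_hd_last(1,2)[OF tp] by auto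
    have endB: "last p = last q" if "links (v # B) \<subseteq> Links Q"
      using common_walk_end[OF S Q p(1) pX qQ q_def w(2) vq False that] pX ne by simp
    have endX: "hd p = last q" if "links (v # rev X) \<subseteq> Links Q"
      using common_walk_end[OF S Q rp qQ q_def w(2) vq False that] pX ne by (simp add: last_rev)
    have "hd p \<noteq> last p" "s \<noteq> last q" using tpath_hd_last(3) tp tq hd_q by auto
    \<comment> \<open>A half of \<open>p\<close> inside \<open>Q\<close> ends at
      \<open>last q\<close>, which is not \<open>s\<close>. So if \<open>s\<close> is an end of
      \<open>p\<close>, the half towards \<open>s\<close> is not inside \<open>Q\<close>; otherwise
      at least one half is not, because the two ends of \<open>p\<close> differ. That half is
      abandoned.\<close>
    then consider "hd p \<noteq> s" "\<not> links (v # B) \<subseteq> Links Q" | "last p \<noteq> s" "\<not> links (v # rev X) \<subseteq> Links Q"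
      using endB endX by metis
    then show ?thesis
    proof cases
      case 1
      then obtain l where l: "l \<in> links (v # B)" "l \<notin> Links Q" by blast
      have neq: "hd p \<noteq> hd q" using 1 hd_q by simp
      obtain S' where S': "system S'"
        "\<And>t. t \<in> T \<Longrightarrow> cnt S' t = cnt S t + unit_vector (hd q) t - unit_vector (last p) t"
        "card (Links S' - Links Q) < card (Links S - Links Q)"
        by (rule reroute[OF S Q p(1) pX qQ qC False CS neq l]) (assumption, rule that)
      show ?thesis by (rule release[OF S'(1) tpath_hd_last(2)[OF tp] _ S'(3)]) (simp add: S'(2) hd_q)
    next
      case 2
      then obtain l where l: "l \<in> links (v # rev X)" "l \<notin> Links Q" by blast
      have neq: "hd (rev p) \<noteq> hd q" using 2 hd_q by (simp add: hd_rev)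
      obtain S' where S': "system S'"
        "\<And>t. t \<in> T \<Longrightarrow> cnt S' t = cnt S t + unit_vector (hd q) t - unit_vector (last (rev p)) t"
        "card (Links S' - Links Q) < card (Links S - Links Q)"
        by (rule reroute[OF S Q rp qQ qC False CS neq l]) (assumption, rule that)
      show ?thesis
        by (rule release[OF S'(1) tpath_hd_last(1)[OF tp] _ S'(3)]) (simp add: S'(2) hd_q last_rev)
    qed
  qed
qed

lemma steppable_remove:
  assumes S: "system S" and Q: "system Q" and s: "s \<in> T" "cnt S s > cnt Q s"
  shows "steppable Q (\<lambda>t. cnt S t - unit_vector s t)"
proof -
  have "\<not> {w. (s, w) \<in> Links S} \<subseteq> {w. (s, w) \<in> Links Q}"
    using s(2) card_mono[OF finite_neighbours[OF Q, of s], of "{w. (s, w) \<in> Links S}"]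
    unfolding cnt_eq_card_Links[OF S s(1)] cnt_eq_card_Links[OF Q s(1)] by linarith
  then obtain w where w: "(s, w) \<in> Links S" "(s, w) \<notin> Links Q" by blast
  obtain p' where p': "s # w # p' \<in> both S" by (rule Links_terminal[OF S w(1) s(1)])
  define b where "b = last (s # w # p')"
  define S' where "S' = S - {s # w # p', rev (s # w # p')}"
  note S' = system_remove[OF S p' S'_def]
  show ?thesis
  proof (rule steppable_release)
    show "system S'" by fact
    show b: "b \<in> T" using tpath_hd_last(2) both_tpath[OF S p'] unfolding b_def .
    show "cnt S' t = cnt S t - unit_vector s t - unit_vector b t" if "t \<in> T" for t
      using S'(2)[OF that] by (simp add: b_def)
    show "steppable Q (\<lambda>t. cnt S' t + unit_vector b t)" if "cnt S' b < cnt Q b"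
      by (rule steppable_add[OF S'(1) Q b that])
  qed
qed

end

section \<open>From path systems to jump systems\<close>

text \<open>Reduces each half of the theorem to an auxiliary graph whose systems realize exactly the
  vectors in \<open>J\<close>. The sum type lets edges of the given graph serve as further
  vertices.\<close>

lemma jump_system_of_systems:
  fixes A :: "(('v + 'e) \<times> ('v + 'e)) set"
  assumes A: "terminal_graph A (Inl ` T)"
    and J: "\<And>m. m \<in> J \<longleftrightarrow> m \<in> int_vectors T \<and>
      (\<exists>R. terminal_graph.system A (Inl ` T) R \<and> (\<forall>t \<in> T. m t = cnt R (Inl t)))"
  shows "jump_system T J"
proof -
  interpret terminal_graph A "Inl ` T" by (rule A)
  have unit: "unit_vector (Inl u :: 'v + 'e) (Inl t) = unit_vector u t" for u t :: 'v
    by (simp add: unit_vector_def)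
  \<comment> \<open>\<open>steppable\<close> looks at terminals only, so vanishing outside
    \<open>T\<close> is carried along separately.\<close>
  have second_step: "\<exists>x''. is_step T x' y x'' \<and> x'' \<in> J"
    if st: "steppable Q z" and x': "x' \<in> int_vectors T" "\<And>t. t \<in> T \<Longrightarrow> x' t = z (Inl t)"
      and y: "\<And>t. t \<in> T \<Longrightarrow> y t = cnt Q (Inl t)" for x' y z Q
  proof -
    obtain R u where R: "system R" "u \<in> T"
      "z (Inl u) < cnt Q (Inl u) \<and> (\<forall>t \<in> T. cnt R (Inl t) = z (Inl t) + unit_vector u t) \<or>
       z (Inl u) > cnt Q (Inl u) \<and> (\<forall>t \<in> T. cnt R (Inl t) = z (Inl t) - unit_vector u t)"
      using st unfolding steppable_def by (auto simp: unit)
    from R(3) show ?thesis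
    proof
      assume *: "z (Inl u) < cnt Q (Inl u) \<and> (\<forall>t \<in> T. cnt R (Inl t) = z (Inl t) + unit_vector u t)"
      let ?x = "\<lambda>t. x' t + unit_vector u t"
      have "?x \<in> int_vectors T" using x'(1) R(2) by (auto simp: int_vectors_def unit_vector_def)
      moreover have "\<forall>t \<in> T. ?x t = cnt R (Inl t)" using * x'(2) by simp
      ultimately have "?x \<in> J" unfolding J using R(1) by blast
      moreover have "x' u < y u" using * x'(2)[OF R(2)] y[OF R(2)] by simp
      then have "is_step T x' y ?x" unfolding is_step_def using R(2) by blast
      ultimately show ?thesis by blast
    next
      assume *: "z (Inl u) > cnt Q (Inl u) \<and> (\<forall>t \<in> T. cnt R (Inl t) = z (Inl t) - unit_vector u t)"
      let ?x = "\<lambda>t. x' t - unit_vector u t"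
      have "?x \<in> int_vectors T" using x'(1) R(2) by (auto simp: int_vectors_def unit_vector_def)
      moreover have "\<forall>t \<in> T. ?x t = cnt R (Inl t)" using * x'(2) by simp
      ultimately have "?x \<in> J" unfolding J using R(1) by blast
      moreover have "x' u > y u" using * x'(2)[OF R(2)] y[OF R(2)] by simp
      then have "is_step T x' y ?x" unfolding is_step_def using R(2) by blast
      ultimately show ?thesis by blast
    qed
  qed
  show ?thesis unfolding jump_system_def
  proof (intro conjI ballI allI impI)
    show "J \<subseteq> int_vectors T" using J by blast
    fix x y x' assume x: "x \<in> J" and y: "y \<in> J" and step: "is_step T x y x'"
    obtain S where S: "system S" "\<And>t. t \<in> T \<Longrightarrow> x t = cnt S (Inl t)" using x J by blast
    obtain Q where Q: "system Q" "\<And>t. t \<in> T \<Longrightarrow> y t = cnt Q (Inl t)" using y J by blast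
    have xT: "x \<in> int_vectors T" using x J by blast
    from step consider "x' = x"
      | s where "s \<in> T" "x s < y s" "x' = (\<lambda>t. x t + unit_vector s t)"
      | s where "s \<in> T" "x s > y s" "x' = (\<lambda>t. x t - unit_vector s t)"
      unfolding is_step_def by blast
    then show "x' \<in> J \<or> (\<exists>x''. is_step T x' y x'' \<and> x'' \<in> J)"
    proof cases
      case 1
      then show ?thesis using x by simp
    next
      case 2
      have "steppable Q (\<lambda>t. cnt S t + unit_vector (Inl s) t)"
        by (rule steppable_add) (use S Q 2 in auto)
      then have "\<exists>x''. is_step T x' y x'' \<and> x'' \<in> J"
        by (rule second_step) (use 2 S Q xT in \<open>auto simp: unit int_vectors_def unit_vector_def\<close>)
      then show ?thesis ..
    next
      case 3
      have "steppable Q (\<lambda>t. cnt S t - unit_vector (Inl s) t)"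
        by (rule steppable_remove) (use S Q 3 in auto)
      then have "\<exists>x''. is_step T x' y x'' \<and> x'' \<in> J"
        by (rule second_step) (use 3 S Q xT in \<open>auto simp: unit int_vectors_def unit_vector_def\<close>)
      then show ?thesis ..
    qed
  qed
qed

section \<open>Paths as vertex and edge lists\<close>

fun path_list :: "('v, 'e) ugraph \<Rightarrow> 'v list \<Rightarrow> 'e list \<Rightarrow> bool" where
  "path_list G [v] [] \<longleftrightarrow> v \<in> verts G"
| "path_list G (v # w # vs) (e # es) \<longleftrightarrow>
     v \<in> verts G \<and> e \<in> edges G \<and> ends G e = {v, w} \<and> v \<notin> set (w # vs) \<and> path_list G (w # vs) es"
| "path_list G _ _ \<longleftrightarrow> False"

lemma path_list_iff:
  "path_list G vs es \<longleftrightarrow> length vs = Suc (length es) \<and> distinct vs \<and>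
     set vs \<subseteq> verts G \<and> set es \<subseteq> edges G \<and>
     (\<forall>i < length es. ends G (es ! i) = {vs ! i, vs ! Suc i})"
  by (induction G vs es rule: path_list.induct) (auto simp: All_less_Suc2)

lemma path_between_iff:
  "path_between G s t P \<longleftrightarrow>
     (\<exists>vs es. path_list G vs es \<and> hd vs = s \<and> last vs = t \<and> P = (set vs, set es))"
  unfolding path_between_def path_list_iff by (cases P) auto

lemma path_list_rev:
  assumes "path_list G vs es" shows "path_list G (rev vs) (rev es)"
proof -
  have l: "length vs = Suc (length es)" using assms by (simp add: path_list_iff)
  have "ends G (rev es ! i) = {rev vs ! i, rev vs ! Suc i}" if "i < length es" for i
  proof -
    have "ends G (es ! (length es - Suc i)) =
        {vs ! (length es - Suc i), vs ! Suc (length es - Suc i)}"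
      using assms that by (simp add: path_list_iff)
    moreover have "Suc (length es - Suc i) = length es - i" using that by simp
    ultimately show ?thesis using that l by (simp add: rev_nth insert_commute)
  qed
  then show ?thesis using assms by (simp add: path_list_iff)
qed

lemma path_list_edge:
  "path_list G vs es \<Longrightarrow> e \<in> set es \<Longrightarrow> e \<in> edges G \<and> ends G e \<subseteq> set vs"
  by (induction G vs es rule: path_list.induct) auto

text \<open>The first vertex does not recur, whereas the ends of every later edge lie among the
  later vertices.\<close>

lemma path_list_distinct_edges: "path_list G vs es \<Longrightarrow> distinct es"
  by (induction G vs es rule: path_list.induct) (auto dest: path_list_edge)

lemma path_list_suffix:
  "path_list G (X @ u # Y) es \<Longrightarrow> \<exists>es'. path_list G (u # Y) es' \<and> set es' \<subseteq> set es"
proof (induction X arbitrary: es)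
  case (Cons x X)
  obtain z Z where z: "X @ u # Y = z # Z" by (cases X) auto
  obtain e es0 where es: "es = e # es0" using Cons.prems z by (cases es) auto
  have "path_list G (X @ u # Y) es0" using Cons.prems z es by simp
  then show ?case using Cons.IH es by fastforce
qed auto

lemma T_pathI:
  assumes "path_list G vs es" "hd vs \<noteq> last vs" "set vs \<inter> T = {hd vs, last vs}"
  shows "T_path G T (set vs, set es)"
  unfolding T_path_def path_between_iff using assms by auto

lemma T_pathE:
  assumes "T_path G T P"
  obtains s ns t es where "path_list G (s # ns @ [t]) es" "s \<in> T" "t \<in> T" "set ns \<inter> T = {}"
    "P = (set (s # ns @ [t]), set es)" "s \<noteq> t"
proof -
  obtain vs es where vs: "path_list G vs es" "hd vs \<noteq> last vs" "set vs \<inter> T = {hd vs, last vs}"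
    "P = (set vs, set es)"
    using assms unfolding T_path_def path_between_iff by auto
  obtain s q where s: "vs = s # q" using vs(1) by (cases vs) auto
  obtain ns t where q: "q = ns @ [t]" using s vs(2) by (cases q rule: rev_cases) auto
  have "distinct vs" using vs(1) by (simp add: path_list_iff)
  then have "set ns \<inter> T = {}" using vs(3) s q by auto
  moreover have "s \<in> T" "t \<in> T" using vs(3) s q by auto
  moreover have "s \<noteq> t" using vs(2) s q by auto
  ultimately show thesis using that[of s ns t es] vs s q by simp
qed

text \<open>A terminal on a T-path is an end of it, and each end starts a traversal, the given one
  or its reversal. Counting endpoints thereby becomes counting incidences, as in
  \<open>cnt\<close>.\<close>

lemma is_endpoint_iff:
  assumes "T_path G T P" "t \<in> T"
  shows "is_endpoint G P t \<longleftrightarrow> t \<in> path_verts P"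
proof
  assume "is_endpoint G P t"
  then show "t \<in> path_verts P"
    unfolding is_endpoint_def path_between_iff
    by (metis fst_conv hd_in_set list.size(3) nat.distinct(1) path_list_iff)
next
  assume t: "t \<in> path_verts P"
  obtain a ns b es where P: "path_list G (a # ns @ [b]) es" "set ns \<inter> T = {}"
    "P = (set (a # ns @ [b]), set es)"
    using assms(1) by (rule T_pathE)
  have "t = a \<or> t = b" using t P assms(2) by auto
  moreover have "is_endpoint G P a" unfolding is_endpoint_def path_between_iff
    using P(1,3) by (intro exI[of _ b] exI[of _ "a # ns @ [b]"] exI[of _ es]) simp
  moreover have "is_endpoint G P b" unfolding is_endpoint_def path_between_iff
    using path_list_rev[OF P(1)] P(3)
    by (intro exI[of _ a] exI[of _ "rev (a # ns @ [b])"] exI[of _ "rev es"]) auto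
  ultimately show "is_endpoint G P t" by blast
qed

lemma T_path_ends_subset: "T_path G T P \<Longrightarrow> e \<in> path_edges P \<Longrightarrow> ends G e \<subseteq> path_verts P"
  by (elim T_pathE) (metis fst_conv path_list_edge snd_conv)

lemma T_path_edges_nonempty: "T_path G T P \<Longrightarrow> path_edges P \<noteq> {}"
  by (elim T_pathE) (auto simp: path_list_iff)

lemma card_endpoints_eq_cnt:
  assumes "bij_betw f R \<P>" "\<And>p. p \<in> R \<Longrightarrow> T_path G T (f p)" "t \<in> T"
    "\<And>p. p \<in> R \<Longrightarrow> t \<in> path_verts (f p) \<longleftrightarrow> Inl t \<in> set p"
  shows "int (card {P \<in> \<P>. is_endpoint G P t}) = cnt R (Inl t)"
proof -
  have "bij_betw f {p \<in> R. Inl t \<in> set p} {P \<in> \<P>. is_endpoint G P t}"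
    using assms(1) is_endpoint_iff[OF assms(2,3)] assms(4)
    unfolding bij_betw_def by (auto intro: inj_on_subset)
  then show ?thesis unfolding cnt_def by (simp add: bij_betw_same_card)
qed

section \<open>Openly disjoint paths via subdivision\<close>

text \<open>The incidence graph, that is, \<open>G\<close> with every edge subdivided. A loop
  becomes a vertex with a single neighbour and lies on no T-path.\<close>

definition vertex_links :: "('v, 'e) ugraph \<Rightarrow> (('v + 'e) \<times> ('v + 'e)) set" where
  "vertex_links G = {(Inl v, Inr e) | v e. e \<in> edges G \<and> v \<in> ends G e} \<union>
     {(Inr e, Inl v) | v e. e \<in> edges G \<and> v \<in> ends G e}"

lemma terminal_graph_vertex_links:
  assumes "finite_ugraph G"
  shows "terminal_graph (vertex_links G) (Inl ` T)"
proof
  have "vertex_links G \<subseteq> (Inl ` verts G \<union> Inr ` edges G) \<times> (Inl ` verts G \<union> Inr ` edges G)"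
    using assms by (fastforce simp: vertex_links_def finite_ugraph_def)
  then show "finite (vertex_links G)"
    by (rule finite_subset) (use assms in \<open>auto simp: finite_ugraph_def\<close>)
qed (auto simp: vertex_links_def)

lemma ends_eq_doubleton:
  assumes "finite_ugraph G" "e \<in> edges G" "u \<in> ends G e" "v \<in> ends G e" "u \<noteq> v"
  shows "ends G e = {u, v}"
proof -
  have c: "card (ends G e) = 1 \<or> card (ends G e) = 2"
    using assms(1,2) by (auto simp: finite_ugraph_def)
  then have "finite (ends G e)" by (metis card.infinite zero_neq_numeral zero_neq_one)
  moreover have "{u, v} \<subseteq> ends G e" "card {u, v} = 2" using assms(3-5) by auto
  ultimately show ?thesis using c card_seteq[of "ends G e" "{u, v}"] by auto
qed

text \<open>A path has one vertex more than edges, so the recursion ends in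
  \<open>interleave [v] []\<close>, the single entry \<open>Inl v\<close>.\<close>

fun interleave :: "'v list \<Rightarrow> 'e list \<Rightarrow> ('v + 'e) list" where
  "interleave (v # vs) (e # es) = Inl v # Inr e # interleave vs es"
| "interleave vs [] = map Inl vs"
| "interleave [] es = map Inr es"

lemma interleave_set: "set (interleave vs es) = Inl ` set vs \<union> Inr ` set es"
  by (induction vs es rule: interleave.induct) auto

lemma interleave_Cons_neq_Nil [simp]: "interleave (v # vs) es \<noteq> []"
  by (cases es) auto

lemma interleave_path:
  assumes "path_list G vs es"
  shows "distinct (interleave vs es)" "links (interleave vs es) \<subseteq> vertex_links G"
    "hd (interleave vs es) = Inl (hd vs)" "last (interleave vs es) = Inl (last vs)"
    "interleave vs es \<noteq> []"
proof -
  show "distinct (interleave vs es)"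
    using assms by (induction G vs es rule: path_list.induct)
      (auto simp: interleave_set dest: path_list_edge)
  show "interleave vs es \<noteq> []" and hd: "hd (interleave vs es) = Inl (hd vs)"
    using assms by (cases rule: path_list.cases[of "(G, vs, es)"]; simp)+
  show "last (interleave vs es) = Inl (last vs)"
    using assms
    by (induction G vs es rule: path_list.induct) auto
  show "links (interleave vs es) \<subseteq> vertex_links G"
    using assms
  proof (induction G vs es rule: path_list.induct)
    case (2 G v w vs e es)
    obtain p where "interleave (w # vs) es = Inl w # p" by (cases es) auto
    then show ?case using 2 by (auto simp: vertex_links_def)
  qed auto
qed

text \<open>Links alternate between vertices and edges, so two entries are peeled off at a time.
  Distinctness makes the vertices before and after an edge different, which excludes loops and
  determines the ends of the edge.\<close>

lemma path_interleave:
  assumes "finite_ugraph G"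
  shows "links p \<subseteq> vertex_links G \<Longrightarrow> distinct p \<Longrightarrow> p \<noteq> [] \<Longrightarrow> hd p = Inl v \<Longrightarrow> v \<in> verts G \<Longrightarrow>
    last p = Inl u \<Longrightarrow> \<exists>vs es. path_list G (v # vs) es \<and> p = interleave (v # vs) es"
proof (induction p arbitrary: v rule: induct_list012)
  case (2 x)
  then show ?case by (intro exI[of _ "[]"]) auto
next
  case (3 x y p)
  have x: "x = Inl v" using 3 by simp
  have "(Inl v, y) \<in> vertex_links G" using 3 x by simp
  then obtain e where y: "y = Inr e" and e: "e \<in> edges G" "v \<in> ends G e"
    by (auto simp: vertex_links_def)
  obtain z p' where p: "p = z # p'" using 3 y by (cases p) auto
  have "(Inr e, z) \<in> vertex_links G" using 3 y p by simp
  then obtain w where z: "z = Inl w" and w: "w \<in> ends G e" by (auto simp: vertex_links_def)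
  have "v \<noteq> w" using 3 x p z by auto
  then have ends: "ends G e = {v, w}" using ends_eq_doubleton[OF assms] e w by blast
  have "w \<in> verts G" using assms e w by (auto simp: finite_ugraph_def)
  then obtain vs es where vs: "path_list G (w # vs) es" "p = interleave (w # vs) es"
    using 3 p z by fastforce
  have "v \<notin> set (w # vs)" using 3 x vs(2) interleave_set[of "w # vs" es] by auto
  then have "path_list G (v # w # vs) (e # es)" using vs(1) ends e 3(7) by simp
  then show ?case using vs(2) x y by (intro exI[of _ "w # vs"] exI[of _ "e # es"]) simp
qed simp

text \<open>If a T-path has an inner vertex, each of its edges has an inner vertex as an
  end.\<close>

lemma T_path_terminal_edge:
  assumes "T_path G T P" "e \<in> path_edges P" "ends G e \<subseteq> T"
  shows "P = (ends G e, {e})"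
proof -
  obtain s ns t es where P: "path_list G (s # ns @ [t]) es" "set ns \<inter> T = {}"
    "P = (set (s # ns @ [t]), set es)"
    using assms(1) by (rule T_pathE)
  obtain i where i: "i < length es" "es ! i = e" using assms(2) P(3) by (auto simp: in_set_conv_nth)
  have e: "ends G e = {(s # ns @ [t]) ! i, (ns @ [t]) ! i}" and l: "length es = Suc (length ns)"
    using P(1) i by (auto simp: path_list_iff)
  show ?thesis
  proof (cases ns)
    case Nil
    then have "i = 0" "es = [e]" using l i by (auto simp: length_Suc_conv)
    then show ?thesis using e P(3) Nil by simp
  next
    case (Cons n ns')
    have "\<exists>x \<in> ends G e. x \<in> set ns"
    proof (cases i)
      case 0
      then show ?thesis using e Cons by simp
    next
      case (Suc j)
      then have "j < length ns" using i l by simp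
      then show ?thesis using e Suc by (simp add: nth_append)
    qed
    then show ?thesis using assms(3) P(2) by blast
  qed
qed

text \<open>Edges become vertices of the subdivision and must not be shared there. A common edge
  would have both ends in \<open>T\<close>, so each of the two paths would consist of it
  alone.\<close>

lemma openly_disjoint_edges:
  assumes "T_path G T P" "T_path G T P'" "P \<noteq> P'" "path_verts P \<inter> path_verts P' \<subseteq> T"
  shows "path_edges P \<inter> path_edges P' = {}"
proof (rule ccontr)
  assume "path_edges P \<inter> path_edges P' \<noteq> {}"
  then obtain e where e: "e \<in> path_edges P" "e \<in> path_edges P'" by blast
  have "ends G e \<subseteq> path_verts P" "ends G e \<subseteq> path_verts P'"
    by (rule T_path_ends_subset[OF assms(1) e(1)], rule T_path_ends_subset[OF assms(2) e(2)])
  then have "ends G e \<subseteq> T" using assms(4) by blast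
  then show False using T_path_terminal_edge assms(1-3) e by metis
qed

lemma vertex_feasible_iff:
  assumes G: "finite_ugraph G" and T: "T \<subseteq> verts G"
  shows "vertex_feasible G T m \<longleftrightarrow>
    (\<exists>R. terminal_graph.system (vertex_links G) (Inl ` T) R \<and> (\<forall>t \<in> T. m t = cnt R (Inl t)))"
proof -
  interpret terminal_graph "vertex_links G" "Inl ` T" by (rule terminal_graph_vertex_links[OF G])
  \<comment> \<open>\<open>f\<close> forgets the order, so both orientations of a list give the same
    subgraph.\<close>
  define f :: "('a + 'b) list \<Rightarrow> ('a, 'b) upath" where "f p = (Inl -` set p, Inr -` set p)" for p
  have f_interleave: "f (interleave vs es) = (set vs, set es)" for vs es
    by (auto simp: f_def interleave_set)
  have to_list: "\<exists>p. tpath p \<and> f p = P" if TP: "T_path G T P" for P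
  proof -
    obtain s ns t es where P: "path_list G (s # ns @ [t]) es" "s \<in> T" "t \<in> T" "set ns \<inter> T = {}"
      "P = (set (s # ns @ [t]), set es)" "s \<noteq> t"
      using TP by (rule T_pathE)
    note p = interleave_path[OF P(1)]
    have "tpath (interleave (s # ns @ [t]) es)"
      by (rule tpathI[OF p(1,2,5)], unfold p(3,4) interleave_set) (use P in auto)
    then show ?thesis using P(5) f_interleave by metis
  qed
  have from_list: "T_path G T (f p)" if tp: "tpath p" for p
  proof -
    obtain s t where st: "hd p = Inl s" "last p = Inl t" "s \<in> T" "t \<in> T" "s \<noteq> t"
      using tpath_hd_last(1-3)[OF tp] by auto
    then obtain vs es where vs: "path_list G (s # vs) es" "p = interleave (s # vs) es"
      using path_interleave[OF G, of p s t] tpath_hd_last(4-6)[OF tp] T by blast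
    have lt: "last (s # vs) = t" using interleave_path(4)[OF vs(1)] st(2) vs(2) by simp
    have "x = s \<or> x = t" if "x \<in> set (s # vs)" "x \<in> T" for x
      using tpath_ends[OF \<open>tpath p\<close>, of "Inl x"] that st vs(2) interleave_set[of "s # vs" es] by auto
    then have "set (s # vs) \<inter> T = {s, t}" using st lt last_in_set[of "s # vs"] by auto
    then have "T_path G T (set (s # vs), set es)" using st lt by (intro T_pathI[OF vs(1)]) auto
    then show ?thesis using f_interleave vs(2) by metis
  qed
  show ?thesis
  proof
    assume "vertex_feasible G T m"
    then obtain \<P> where P: "\<forall>P \<in> \<P>. T_path G T P" "pairwise (openly_disjoint T) \<P>"
      "\<forall>t \<in> T. m t = int (card {P \<in> \<P>. is_endpoint G P t})"
      unfolding vertex_feasible_def by blast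
    obtain r where r: "\<forall>P \<in> \<P>. tpath (r P) \<and> f (r P) = P"
      using bchoice[of \<P> "\<lambda>P p. tpath p \<and> f p = P"] to_list P(1) by blast
    have bij: "bij_betw f (r ` \<P>) \<P>"
      by (rule bij_betw_byWitness[where f' = r]) (use r in auto)
    have "system (r ` \<P>)" unfolding system_def
    proof (intro conjI ballI impI)
      fix p q assume "p \<in> r ` \<P>" "q \<in> r ` \<P>" "p \<noteq> q"
      then obtain P Q where PQ: "P \<in> \<P>" "Q \<in> \<P>" "p = r P" "q = r Q" "P \<noteq> Q" by auto
      then have vd: "path_verts P \<inter> path_verts Q \<subseteq> T"
        using P(2) by (auto simp: pairwise_def openly_disjoint_def)
      have ed: "path_edges P \<inter> path_edges Q = {}"
        using openly_disjoint_edges[OF _ _ PQ(5) vd] P(1) PQ(1,2) by blast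
      have fp: "P = f p" "Q = f q" using r PQ by auto
      show "set p \<inter> set q \<subseteq> Inl ` T"
      proof
        fix x assume "x \<in> set p \<inter> set q"
        then show "x \<in> Inl ` T" using vd ed unfolding fp f_def by (cases x) auto
      qed
    qed (use r in auto)
    moreover have "\<forall>t \<in> T. m t = cnt (r ` \<P>) (Inl t)"
    proof
      fix t assume t: "t \<in> T"
      have "int (card {P \<in> \<P>. is_endpoint G P t}) = cnt (r ` \<P>) (Inl t)"
        by (rule card_endpoints_eq_cnt[OF bij _ t]) (use r P(1) in \<open>auto simp: f_def\<close>)
      then show "m t = cnt (r ` \<P>) (Inl t)" using P(3) t by simp
    qed
    ultimately show "\<exists>R. system R \<and> (\<forall>t \<in> T. m t = cnt R (Inl t))" by blast
  next
    assume "\<exists>R. system R \<and> (\<forall>t \<in> T. m t = cnt R (Inl t))"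
    then obtain R where R: "system R" "\<forall>t \<in> T. m t = cnt R (Inl t)" by blast
    have tp: "tpath p" if "p \<in> R" for p using R(1) that by (simp add: system_def)
    have disj: "set p \<inter> set q \<subseteq> Inl ` T" if "p \<in> R" "q \<in> R" "p \<noteq> q" for p q
      using R(1) that unfolding system_def by blast
    \<comment> \<open>Every path has an edge, and a shared edge is a shared nonterminal vertex of
      the subdivision.\<close>
    have inj: "inj_on f R"
    proof (rule inj_onI, rule ccontr)
      fix p q assume pq: "p \<in> R" "q \<in> R" "f p = f q" "p \<noteq> q"
      obtain e where "e \<in> path_edges (f p)" using T_path_edges_nonempty[OF from_list[OF tp[OF pq(1)]]] by blast
      then have "Inr e \<in> set p \<inter> set q" using pq(3) by (auto simp: f_def)
      then show False using disj[OF pq(1,2,4)] by auto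
    qed
    show "vertex_feasible G T m" unfolding vertex_feasible_def
    proof (intro exI conjI ballI)
      show "T_path G T P" if "P \<in> f ` R" for P using that from_list tp by blast
      show "pairwise (openly_disjoint T) (f ` R)"
      proof (rule pairwiseI)
        fix P Q assume "P \<in> f ` R" "Q \<in> f ` R" "P \<noteq> Q"
        then obtain p q where "p \<in> R" "q \<in> R" "p \<noteq> q" "P = f p" "Q = f q" by auto
        then show "openly_disjoint T P Q" using disj[of p q] by (auto simp: openly_disjoint_def f_def)
      qed
      show "m t = int (card {P \<in> f ` R. is_endpoint G P t})" if "t \<in> T" for t
      proof -
        have "int (card {P \<in> f ` R. is_endpoint G P t}) = cnt R (Inl t)"
          by (rule card_endpoints_eq_cnt[OF inj_on_imp_bij_betw[OF inj] _ that])
            (use from_list tp in \<open>auto simp: f_def\<close>)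
        then show ?thesis using R(2) that by simp
      qed
    qed
  qed
qed

section \<open>Edge-disjoint paths via the line graph\<close>

text \<open>Edges that meet only in terminals are not adjacent, because a T-path cannot pass through
  a terminal. Pairing an edge with itself does no harm, as the lists in \<open>tpath\<close> are
  distinct.\<close>

definition edge_links :: "('v, 'e) ugraph \<Rightarrow> 'v set \<Rightarrow> (('v + 'e) \<times> ('v + 'e)) set" where
  "edge_links G T =
     {(Inl t, Inr e) | t e. t \<in> T \<and> e \<in> edges G \<and> t \<in> ends G e} \<union>
     {(Inr e, Inl t) | t e. t \<in> T \<and> e \<in> edges G \<and> t \<in> ends G e} \<union>
     {(Inr e, Inr f) | e f. e \<in> edges G \<and> f \<in> edges G \<and> ends G e \<inter> ends G f - T \<noteq> {}}"

lemma terminal_graph_edge_links: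
  assumes "finite_ugraph G"
  shows "terminal_graph (edge_links G T) (Inl ` T)"
proof
  have "edge_links G T \<subseteq> (Inl ` verts G \<union> Inr ` edges G) \<times> (Inl ` verts G \<union> Inr ` edges G)"
    using assms by (fastforce simp: edge_links_def finite_ugraph_def)
  then show "finite (edge_links G T)"
    by (rule finite_subset) (use assms in \<open>auto simp: finite_ugraph_def\<close>)
qed (auto simp: edge_links_def)

text \<open>A path in the line graph need not trace a path of \<open>G\<close>, since it may use
  several edges at one vertex. Induction from the far end: \<open>e\<close> leads to a nonterminal
  \<open>w\<close> shared with the next edge, from where a path to \<open>t\<close> is known. The
  start \<open>u\<close> may be a nonterminal so that \<open>w\<close> can take its place.\<close>

lemma path_along_edges:
  assumes G: "finite_ugraph G" and t: "t \<in> T"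
  shows "es \<noteq> [] \<Longrightarrow> set es \<subseteq> edges G \<Longrightarrow> t \<in> ends G (last es) \<Longrightarrow>
    links es \<subseteq> {(e, f). ends G e \<inter> ends G f - T \<noteq> {}} \<Longrightarrow> u \<in> ends G (hd es) \<Longrightarrow> u \<noteq> t \<Longrightarrow>
    \<exists>vs es'. path_list G (u # vs) es' \<and> last (u # vs) = t \<and> set es' \<subseteq> set es \<and> set (u # vs) \<inter> T \<subseteq> {u, t}"
proof (induction es arbitrary: u rule: induct_list012)
  case (2 e)
  then have "ends G e = {u, t}" using ends_eq_doubleton[OF G] by auto
  moreover have "u \<in> verts G" "t \<in> verts G" using 2 G by (auto simp: finite_ugraph_def)
  ultimately show ?case using 2 by (intro exI[of _ "[t]"] exI[of _ "[e]"]) auto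
next
  case (3 e f es)
  obtain w where w: "w \<in> ends G e" "w \<in> ends G f" "w \<notin> T" using 3 by auto
  obtain vs es' where vs: "path_list G (w # vs) es'" "last (w # vs) = t" "set es' \<subseteq> set (f # es)"
    "set (w # vs) \<inter> T \<subseteq> {w, t}"
    using 3(2)[of w] 3(3-) w t by auto
  show ?case
  proof (cases "u \<in> set (w # vs)")
    \<comment> \<open>\<open>u\<close> is already on the path from \<open>w\<close>, possibly as
      \<open>w\<close> itself; the part from \<open>u\<close> on suffices and \<open>e\<close> is
      skipped.\<close>
    case True
    then obtain X Y where XY: "w # vs = X @ u # Y" by (meson split_list)
    obtain es'' where es'': "path_list G (u # Y) es''" "set es'' \<subseteq> set es'"
      using path_list_suffix[of G X u Y es'] vs(1) unfolding XY by blast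
    have "last (u # Y) = t" using vs(2) XY by simp
    moreover have "set (u # Y) \<inter> T \<subseteq> {u, t}" using vs(4) w(3) unfolding XY by auto
    ultimately show ?thesis using es'' vs(3) by (intro exI[of _ Y] exI[of _ es'']) auto
  next
    case False
    then have "ends G e = {u, w}" using ends_eq_doubleton[OF G] 3 w by auto
    moreover have "u \<in> verts G" using 3 G by (auto simp: finite_ugraph_def)
    ultimately have "path_list G (u # w # vs) (e # es')" using vs(1) False 3 by simp
    moreover have "set (u # w # vs) \<inter> T \<subseteq> {u, t}" using vs(4) w(3) by auto
    ultimately show ?thesis using vs(2,3) by (intro exI[of _ "w # vs"] exI[of _ "e # es'"]) auto
  qed
qed simp

text \<open>The two translations are not inverse to each other: a list of edges may be shortened to
  a path using only some of them. This suffices, because edge-disjointness passes to subsets and the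
  ends are kept.\<close>

lemma edge_feasible_iff:
  assumes G: "finite_ugraph G"
  shows "edge_feasible G T m \<longleftrightarrow>
    (\<exists>R. terminal_graph.system (edge_links G T) (Inl ` T) R \<and> (\<forall>t \<in> T. m t = cnt R (Inl t)))"
proof -
  interpret terminal_graph "edge_links G T" "Inl ` T" by (rule terminal_graph_edge_links[OF G])
  have to_list: "\<exists>p. tpath p \<and> Inr -` set p = path_edges P \<and>
      (\<forall>t \<in> T. Inl t \<in> set p \<longleftrightarrow> t \<in> path_verts P)"
    if TP: "T_path G T P" for P
  proof -
    obtain s ns t es where P: "path_list G (s # ns @ [t]) es" "s \<in> T" "t \<in> T" "set ns \<inter> T = {}"
      "P = (set (s # ns @ [t]), set es)" "s \<noteq> t"
      using TP by (rule T_pathE)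
    have l: "length es = Suc (length ns)" and E: "set es \<subseteq> edges G"
      and ends: "\<And>i. i < length es \<Longrightarrow> ends G (es ! i) = {(s # ns @ [t]) ! i, (ns @ [t]) ! i}"
      using P(1) by (auto simp: path_list_iff)
    define p :: "('a + 'b) list" where "p = Inl s # map Inr es @ [Inl t]"
    obtain e0 es0 where es0: "es = e0 # es0" using l by (cases es) auto
    obtain es1 e1 where es1: "es = es1 @ [e1]" using l by (cases es rule: rev_cases) auto
    have l1: "links p = insert (Inl s, Inr e0) (links (map Inr es @ [Inl t]))"
      unfolding p_def es0 by simp
    have l2: "links (map Inr es @ [Inl t :: 'a + 'b]) = insert (Inr e1, Inl t) (links (map Inr es))"
      using links_append_Cons[of "map Inr es1" "Inr e1" "[Inl t :: 'a + 'b]"] unfolding es1 by auto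
    have "s \<in> ends G e0" using ends[of 0] es0 by simp
    then have 1: "(Inl s, Inr e0) \<in> edge_links G T" using P(2) E es0 by (auto simp: edge_links_def)
    have "t \<in> ends G e1" using ends[of "length ns"] es1 l by (auto simp: nth_append)
    then have 2: "(Inr e1, Inl t) \<in> edge_links G T" using P(3) E es1 by (auto simp: edge_links_def)
    have 3: "links (map Inr es) \<subseteq> edge_links G T"
    proof safe
      fix u v :: "'a + 'b" assume "(u, v) \<in> links (map Inr es)"
      then obtain i where i: "Suc i < length es" "u = Inr (es ! i)" "v = Inr (es ! Suc i)"
        by (auto dest!: links_nth)
      \<comment> \<open>Edges \<open>i\<close> and \<open>Suc i\<close> share the vertex at position
        \<open>Suc i\<close> of the path, which is \<open>ns ! i\<close> and thus not a
        terminal.\<close>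
      have "(ns @ [t]) ! i = ns ! i" "ns ! i \<in> set ns" using i l by (auto simp: nth_append)
      then have "ns ! i \<in> ends G (es ! i) \<inter> ends G (es ! Suc i) - T"
        using ends[of i] ends[of "Suc i"] i P(4) by auto
      then show "(u, v) \<in> edge_links G T" using i E nth_mem by (fastforce simp: edge_links_def)
    qed
    have "tpath p"
    proof (rule tpathI)
      show "distinct p" using path_list_distinct_edges[OF P(1)] P(6)
        by (auto simp: p_def distinct_map)
      show "links p \<subseteq> edge_links G T" using 1 2 3 l1 l2 by auto
    qed (use P in \<open>auto simp: p_def\<close>)
    moreover have "Inr -` set p = path_edges P" using P(5) by (auto simp: p_def)
    moreover have "\<forall>x \<in> T. Inl x \<in> set p \<longleftrightarrow> x \<in> path_verts P" using P(4,5) by (auto simp: p_def)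
    ultimately show ?thesis by blast
  qed
  have from_list: "\<exists>P. T_path G T P \<and> path_edges P \<subseteq> Inr -` set p \<and>
      (\<forall>t \<in> T. t \<in> path_verts P \<longleftrightarrow> Inl t \<in> set p)"
    if tp: "tpath p" for p
  proof -
    obtain x w X y where p: "p = x # w # X @ [y]" "x \<in> Inl ` T" "y \<in> Inl ` T" "w \<notin> Inl ` T"
      "set X \<inter> Inl ` T = {}" "links p \<subseteq> edge_links G T" "x \<noteq> y"
      using tp by (rule tpathE)
    obtain s t where st: "x = Inl s" "y = Inl t" "s \<in> T" "t \<in> T" "s \<noteq> t" using p by blast
    \<comment> \<open>An entry between the two ends is not a terminal but has a link to its
      successor; in \<open>edge_links\<close> such an entry is an edge.\<close>
    have rng: "z \<in> Inr ` edges G" if z: "z \<in> set (w # X)" for z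
    proof -
      obtain Y Z where YZ: "w # X = Y @ z # Z" using z by (meson split_list)
      obtain a Z' where "Z @ [y] = a # Z'" by (cases Z) auto
      moreover have "p = x # (w # X) @ [y]" using p(1) by simp
      ultimately have "p = (x # Y) @ z # a # Z'" unfolding YZ by simp
      then have "(z, a) \<in> links p" using linksI by metis
      then have "(z, a) \<in> edge_links G T" using p(6) by blast
      moreover have "z \<notin> Inl ` T" using that p(4,5) by auto
      ultimately show ?thesis by (auto simp: edge_links_def)
    qed
    then obtain es where es: "w # X = map Inr es" by (metis ex_map_conv imageE)
    have esE: "set es \<subseteq> edges G"
    proof
      fix e assume "e \<in> set es"
      then have "Inr e \<in> set (w # X)" unfolding es by simp
      then show "e \<in> edges G" using rng by blast
    qed
    obtain e0 es0 where es0: "es = e0 # es0" using es by (cases es) auto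
    obtain es1 e1 where es1: "es = es1 @ [e1]" using es by (cases es rule: rev_cases) auto
    have p': "p = Inl s # map Inr es @ [Inl t]" using p(1) es st by simp
    have "(Inl s, Inr e0) \<in> links p" unfolding p' es0 by simp
    then have s: "s \<in> ends G (hd es)" using p(6) es0 by (auto simp: edge_links_def)
    have "p = (Inl s # map Inr es1) @ Inr e1 # Inl t # []" unfolding p' es1 by simp
    then have "(Inr e1, Inl t) \<in> links p" using linksI by metis
    then have t: "t \<in> ends G (last es)" using p(6) es1 by (auto simp: edge_links_def)
    have lk: "links es \<subseteq> {(e, f). ends G e \<inter> ends G f - T \<noteq> {}}"
    proof safe
      fix e f assume ef: "(e, f) \<in> links es" "ends G e \<inter> ends G f - T = {}"
      then obtain Y Z where "es = Y @ e # f # Z" by (auto simp: links_def)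
      then have "p = (Inl s # map Inr Y) @ Inr e # Inr f # map Inr Z @ [Inl t]" unfolding p' by simp
      then have "(Inr e, Inr f) \<in> links p" using linksI by metis
      then show False using p(6) ef(2) by (auto simp: edge_links_def)
    qed
    obtain vs es' where vs: "path_list G (s # vs) es'" "last (s # vs) = t" "set es' \<subseteq> set es"
      "set (s # vs) \<inter> T \<subseteq> {s, t}"
      using path_along_edges[OF G st(4) _ esE t lk s st(5)] es0 by auto
    have vT: "set (s # vs) \<inter> T = {s, t}" using vs(2,4) st(3,4) last_in_set[of "s # vs"] by auto
    have "T_path G T (set (s # vs), set es')"
      by (rule T_pathI[OF vs(1)]) (use vs(2) vT st in auto)
    moreover have "set es' \<subseteq> Inr -` set p" using vs(3) p' by auto
    moreover have "\<forall>x \<in> T. x \<in> set (s # vs) \<longleftrightarrow> Inl x \<in> set p" using vT p' by auto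
    ultimately show ?thesis by (intro exI[of _ "(set (s # vs), set es')"]) simp
  qed
  show ?thesis
  proof
    assume "edge_feasible G T m"
    then obtain \<P> where P: "\<forall>P \<in> \<P>. T_path G T P" "pairwise edge_disjoint \<P>"
      "\<forall>t \<in> T. m t = int (card {P \<in> \<P>. is_endpoint G P t})"
      unfolding edge_feasible_def by blast
    obtain r where r: "\<forall>P \<in> \<P>. tpath (r P) \<and> Inr -` set (r P) = path_edges P \<and>
        (\<forall>t \<in> T. Inl t \<in> set (r P) \<longleftrightarrow> t \<in> path_verts P)"
      using bchoice[of \<P> "\<lambda>P p. tpath p \<and> Inr -` set p = path_edges P \<and>
        (\<forall>t \<in> T. Inl t \<in> set p \<longleftrightarrow> t \<in> path_verts P)"] to_list P(1) by blast
    have disj: "path_edges P \<inter> path_edges Q = {}" if "P \<in> \<P>" "Q \<in> \<P>" "P \<noteq> Q" for P Q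
      using P(2) that by (auto simp: pairwise_def edge_disjoint_def)
    have inj: "inj_on r \<P>"
    proof (rule inj_onI, rule ccontr)
      fix P Q assume PQ: "P \<in> \<P>" "Q \<in> \<P>" "r P = r Q" "P \<noteq> Q"
      then have "path_edges P = path_edges Q" using r by metis
      then show False using disj[OF PQ(1,2,4)] T_path_edges_nonempty[of G T P] P(1) PQ(1) by simp
    qed
    \<comment> \<open>\<open>card_endpoints_eq_cnt\<close> takes a map from lists to paths, hence
      the inverse of the choice \<open>r\<close>.\<close>
    have bij: "bij_betw (inv_into \<P> r) (r ` \<P>) \<P>"
      by (rule bij_betw_inv_into) (rule inj_on_imp_bij_betw[OF inj])
    have "system (r ` \<P>)" unfolding system_def
    proof (intro conjI ballI impI)
      fix p q assume "p \<in> r ` \<P>" "q \<in> r ` \<P>" "p \<noteq> q"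
      then obtain P Q where PQ: "P \<in> \<P>" "Q \<in> \<P>" "p = r P" "q = r Q" "P \<noteq> Q" by auto
      show "set p \<inter> set q \<subseteq> Inl ` T"
      proof
        fix x assume x: "x \<in> set p \<inter> set q"
        show "x \<in> Inl ` T"
        proof (cases x)
          case (Inl v)
          have "tpath p" using r PQ by blast
          \<comment> \<open>The only vertices of \<open>G\<close> occurring in
            \<open>edge_links\<close> are terminals, which settles entries of the form
            \<open>Inl v\<close>.\<close>
          then have "set p \<subseteq> Inl ` T \<union> range Inr"
          proof -
            have "z \<in> Inl ` T \<union> range Inr" if "z \<in> set p" for z
            proof -
              obtain Y Z where YZ: "p = Y @ z # Z" using \<open>z \<in> set p\<close> by (meson split_list)
              show ?thesis
              proof (cases Z)
                case Nil
                then show ?thesis using tpath_hd_last(2)[OF \<open>tpath p\<close>] YZ by simp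
              next
                case (Cons a Z')
                then have "(z, a) \<in> links p" using YZ linksI by metis
                then have "(z, a) \<in> edge_links G T" using tpath_hd_last(6)[OF \<open>tpath p\<close>] by blast
                then show ?thesis by (auto simp: edge_links_def)
              qed
            qed
            then show ?thesis by blast
          qed
          then show ?thesis using x Inl by auto
        next
          case (Inr e)
          then have "e \<in> Inr -` set p" "e \<in> Inr -` set q" using x by auto
          then have "e \<in> path_edges P" "e \<in> path_edges Q" using r PQ by auto
          then show ?thesis using disj[OF PQ(1,2,5)] by blast
        qed
      qed
    qed (use r in auto)
    moreover have "\<forall>t \<in> T. m t = cnt (r ` \<P>) (Inl t)"
    proof
      fix t assume t: "t \<in> T"
      have "int (card {P \<in> \<P>. is_endpoint G P t}) = cnt (r ` \<P>) (Inl t)"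
        by (rule card_endpoints_eq_cnt[OF bij _ t]) (use inj r P(1) t in auto)
      then show "m t = cnt (r ` \<P>) (Inl t)" using P(3) t by simp
    qed
    ultimately show "\<exists>R. system R \<and> (\<forall>t \<in> T. m t = cnt R (Inl t))" by blast
  next
    assume "\<exists>R. system R \<and> (\<forall>t \<in> T. m t = cnt R (Inl t))"
    then obtain R where R: "system R" "\<forall>t \<in> T. m t = cnt R (Inl t)" by blast
    have disj: "set p \<inter> set q \<subseteq> Inl ` T" if "p \<in> R" "q \<in> R" "p \<noteq> q" for p q
      using R(1) that unfolding system_def by blast
    obtain f where f: "\<forall>p \<in> R. T_path G T (f p) \<and> path_edges (f p) \<subseteq> Inr -` set p \<and>
        (\<forall>t \<in> T. t \<in> path_verts (f p) \<longleftrightarrow> Inl t \<in> set p)"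
      using bchoice[of R "\<lambda>p P. T_path G T P \<and> path_edges P \<subseteq> Inr -` set p \<and>
        (\<forall>t \<in> T. t \<in> path_verts P \<longleftrightarrow> Inl t \<in> set p)"] from_list R(1) unfolding system_def by blast
    have ed: "path_edges (f p) \<inter> path_edges (f q) = {}" if "p \<in> R" "q \<in> R" "p \<noteq> q" for p q
    proof (rule ccontr)
      assume "path_edges (f p) \<inter> path_edges (f q) \<noteq> {}"
      then obtain e where "e \<in> path_edges (f p)" "e \<in> path_edges (f q)" by blast
      then have "e \<in> Inr -` set p" "e \<in> Inr -` set q" using f that(1,2) by (meson subsetD)+
      then have "Inr e \<in> set p \<inter> set q" by simp
      then show False using disj[OF that] by auto
    qed
    have inj: "inj_on f R"
    proof (rule inj_onI, rule ccontr)
      fix p q assume pq: "p \<in> R" "q \<in> R" "f p = f q" "p \<noteq> q"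
      then show False using ed[OF pq(1,2,4)] T_path_edges_nonempty[of G T "f p"] f by simp
    qed
    show "edge_feasible G T m" unfolding edge_feasible_def
    proof (intro exI conjI ballI)
      show "T_path G T P" if "P \<in> f ` R" for P using that f by blast
      show "pairwise edge_disjoint (f ` R)"
      proof (rule pairwiseI)
        fix P Q assume "P \<in> f ` R" "Q \<in> f ` R" "P \<noteq> Q"
        then obtain p q where "p \<in> R" "q \<in> R" "p \<noteq> q" "P = f p" "Q = f q" by auto
        then show "edge_disjoint P Q" using ed[of p q] by (simp add: edge_disjoint_def)
      qed
      show "m t = int (card {P \<in> f ` R. is_endpoint G P t})" if "t \<in> T" for t
      proof -
        have "int (card {P \<in> f ` R. is_endpoint G P t}) = cnt R (Inl t)"
          by (rule card_endpoints_eq_cnt[OF inj_on_imp_bij_betw[OF inj] _ that]) (use f that in auto)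
        then show ?thesis using R(2) that by simp
      qed
    qed
  qed
qed

theorem theorem1:
  fixes G :: "('v, 'e) ugraph" and T :: "'v set"
  assumes "finite_ugraph G" and "T \<subseteq> verts G"
  shows "jump_system T (J_vertex G T) \<and> jump_system T (J_edge G T)"
proof
  show "jump_system T (J_vertex G T)"
    by (rule jump_system_of_systems[OF terminal_graph_vertex_links[OF assms(1)]])
      (simp add: J_vertex_def vertex_feasible_iff[OF assms])
  show "jump_system T (J_edge G T)"
    by (rule jump_system_of_systems[OF terminal_graph_edge_links[OF assms(1)]])
      (simp add: J_edge_def edge_feasible_iff[OF assms(1)])
qed

end
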